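(* Let $G$ be a unimodular locally compact group and $1<p\leq 2$. The norms $\|\cdot\|_p$ and $\|\cdot\|_p^T$ are equivalent on $L^{T}_p(G)$ if and only if $G$ is finite.
   Context: $\lambda$ is a fixed left Haar measure on $G$, and $L^p(G)$ is taken with respect to $\lambda$. For measurable $f,g$ the convolution is $f*g(x)=\int_G f(y)g(y^{-1}x)\,d\lambda(y)$; $f*g$ is said to exist if the integrand is $\lambda$-integrable in $y$ for almost all $x\in G$. For $1<p<\infty$, $L_p^T(G)$ is the set of all $f\in L^p(G)$ such that $g*f$ exists for all $g\in L^p(G)$ and $\|f\|_p^T=\sup\{\|g*f\|_p: g\in L^p(G),\ \|g\|_p\le 1\}<\infty$. *)

theory Defs
  imports "HOL-Analysis.Analysis"
begin

text \<open>
  Topological groups are types of class \<^class>\<open>topological_group_add\<close>. The group operation is written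
  additively, but \<^class>\<open>group_add\<close> does not assume commutativity; so \<open>y\<inverse> x\<close> reads \<^term>\<open>- y + x\<close>.
\<close>

definition radon_measure :: "'a::topological_space measure \<Rightarrow> bool" where
  "radon_measure M \<longleftrightarrow>
     sets M = sets borel \<and>
     (\<forall>K. compact K \<longrightarrow> emeasure M K < \<infinity>) \<and>
     (\<forall>A\<in>sets borel. emeasure M A = (INF U\<in>{U. open U \<and> A \<subseteq> U}. emeasure M U)) \<and>
     (\<forall>U. open U \<longrightarrow> emeasure M U = (SUP K\<in>{K. compact K \<and> K \<subseteq> U}. emeasure M K))"

definition left_haar_measure :: "'a::topological_group_add measure \<Rightarrow> bool" where
  "left_haar_measure M \<longleftrightarrow>
     radon_measure M \<and> emeasure M UNIV \<noteq> 0 \<and>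
     (\<forall>x. \<forall>A\<in>sets borel. emeasure M ((\<lambda>y. x + y) ` A) = emeasure M A)"

definition right_haar_measure :: "'a::topological_group_add measure \<Rightarrow> bool" where
  "right_haar_measure M \<longleftrightarrow>
     radon_measure M \<and> emeasure M UNIV \<noteq> 0 \<and>
     (\<forall>x. \<forall>A\<in>sets borel. emeasure M ((\<lambda>y. y + x) ` A) = emeasure M A)"

definition unimodular_group :: "'a::topological_group_add itself \<Rightarrow> bool" where
  "unimodular_group G \<longleftrightarrow> (\<forall>M::'a measure. left_haar_measure M \<longrightarrow> right_haar_measure M)"

text \<open>
  \<open>L\<^sup>p\<close> is represented by the \<open>p\<close>-integrable functions rather than by their classes modulo equality
  almost everywhere; every notion below only depends on the classes.
\<close>

definition Lp_space :: "'a measure \<Rightarrow> real \<Rightarrow> ('a \<Rightarrow> complex) set" where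
  "Lp_space M p = {f \<in> borel_measurable M. integrable M (\<lambda>x. norm (f x) powr p)}"

definition Lp_norm :: "'a measure \<Rightarrow> real \<Rightarrow> ('a \<Rightarrow> complex) \<Rightarrow> real" where
  "Lp_norm M p f = (\<integral>x. norm (f x) powr p \<partial>M) powr (1 / p)"

definition convolution_exists ::
  "'a::topological_group_add measure \<Rightarrow> ('a \<Rightarrow> complex) \<Rightarrow> ('a \<Rightarrow> complex) \<Rightarrow> bool" where
  "convolution_exists M f g \<longleftrightarrow> (AE x in M. integrable M (\<lambda>y. f y * g (- y + x)))"

text \<open>The Bochner integral makes the convolution \<open>0\<close> at the points where the integrand is not integrable.\<close>

definition convolution ::
  "'a::topological_group_add measure \<Rightarrow> ('a \<Rightarrow> complex) \<Rightarrow> ('a \<Rightarrow> complex) \<Rightarrow> 'a \<Rightarrow> complex" where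
  "convolution M f g x = (\<integral>y. f y * g (- y + x) \<partial>M)"

text \<open>
  The norm \<^const>\<open>Lp_norm\<close> is real-valued, and so is the supremum in \<open>LpT_norm\<close>. That this supremum
  is finite is the conjunction of the last two conditions in \<open>LpT_space\<close>: no \<open>g * f\<close> has
  infinite \<open>p\<close>-norm, and the \<open>p\<close>-norms are bounded.
\<close>

definition LpT_space :: "'a::topological_group_add measure \<Rightarrow> real \<Rightarrow> ('a \<Rightarrow> complex) set" where
  "LpT_space M p = {f \<in> Lp_space M p.
     (\<forall>g\<in>Lp_space M p. convolution_exists M g f) \<and>
     (\<forall>g\<in>Lp_space M p. Lp_norm M p g \<le> 1 \<longrightarrow> convolution M g f \<in> Lp_space M p) \<and>
     bdd_above {Lp_norm M p (convolution M g f) | g. g \<in> Lp_space M p \<and> Lp_norm M p g \<le> 1}}"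

definition LpT_norm :: "'a::topological_group_add measure \<Rightarrow> real \<Rightarrow> ('a \<Rightarrow> complex) \<Rightarrow> real" where
  "LpT_norm M p f =
     Sup {Lp_norm M p (convolution M g f) | g. g \<in> Lp_space M p \<and> Lp_norm M p g \<le> 1}"

definition equivalent_norms_on :: "'v set \<Rightarrow> ('v \<Rightarrow> real) \<Rightarrow> ('v \<Rightarrow> real) \<Rightarrow> bool" where
  "equivalent_norms_on V N1 N2 \<longleftrightarrow> (\<exists>c>0. \<exists>C>0. \<forall>f\<in>V. c * N1 f \<le> N2 f \<and> N2 f \<le> C * N1 f)"

end

theory Submission
  imports Defs "HOL-Library.Poly_Mapping" "HOL-Complex_Analysis.Great_Picard"
begin

text \<open>
  Let \<open>U\<close> be a small symmetric neighbourhood of the identity. By Tonelli, convolution with its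
  indicator has norm at most \<open>\<mu>(U)\<close> on \<open>L\<^sup>p\<close>, while the indicator has \<open>p\<close>-norm \<open>\<mu>(U)\<^bsup>1/p\<^esup>\<close>. So
  equivalence of the norms bounds \<open>\<mu>(U)\<close> from below, and \<open>\<mu>\<close> is a multiple of the counting measure
  of a discrete group.

  On a discrete group equivalence says that \<open>\<parallel>f * g\<parallel>\<^sub>p \<le> C \<parallel>f\<parallel>\<^sub>p \<parallel>g\<parallel>\<^sub>p\<close> for finitely supported functions. For
  \<open>f, g \<ge> 0\<close> one also has \<open>\<parallel>f * g\<parallel>\<^sub>p \<ge> \<parallel>f\<parallel>\<^sub>p \<parallel>g\<parallel>\<^sub>p\<close>, since \<open>(\<Sum>a\<^sub>i)\<^sup>p \<ge> \<Sum>a\<^sub>i\<^sup>p\<close>. Hence, for \<open>f \<ge> 0\<close> and a suitable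
  \<open>r\<close>, the powers of \<open>h = f / r\<close> have norms in \<open>[1/C, 1]\<close>. In an infinite group take \<open>f\<close> to be the indicator of
  a finite symmetric set generating an infinite subgroup; it exists because the finite subgroups have
  bounded order. If the powers of \<open>h\<close> tended to \<open>0\<close> pointwise along a subsequence, then \<open>N\<close> of them would
  be almost disjoint, their sum would have norm of order \<open>N\<^bsup>1/p\<^esup>\<close> but spectral radius \<open>N\<close>.
  Otherwise a limit of their Cesaro means is a positive eigenfunction in \<open>\<ell>\<^sup>p \<subseteq> \<ell>\<^sup>2\<close>, which by a
  Perron--Frobenius argument is a multiplicative character, and so cannot be \<open>p\<close>-summable.
\<close>

section \<open>Inequalities for powers\<close>

text \<open>Young's inequality for \<open>h\<close> and \<open>t powr (p - 1)\<close>: the convex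
  function \<open>h powr p\<close> lies above its tangent at \<open>t\<close>. With \<open>t\<close>
  a mean value, summing or integrating over \<open>h\<close> gives Jensen's inequality, in
  \<open>powr_mean_le\<close> and \<open>powr_integral_le\<close>.\<close>

lemma powr_tangent_line:
  fixes h t p :: real
  assumes "0 \<le> h" "0 \<le> t" "1 < p"
  shows "p * t powr (p - 1) * h \<le> h powr p + (p - 1) * t powr p"
proof -
  define q where "q = p / (p - 1)"
  have q: "q > 1" "1 / p + 1 / q = 1" "(p - 1) * q = p"
    using assms(3) by (auto simp: q_def field_simps)
  have "h * t powr (p - 1) \<le> h powr p / p + (t powr (p - 1)) powr q / q"
    by (rule Youngs_inequality) (use assms q in auto)
  also have "(t powr (p - 1)) powr q = t powr p"
    by (simp add: powr_powr q)
  also have "t powr p / q = (p - 1) * t powr p / p"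
    using assms(3) by (simp add: q_def)
  finally have "p * (h * t powr (p - 1)) \<le> p * (h powr p / p + (p - 1) * t powr p / p)"
    using assms(3) by (intro mult_left_mono) auto
  also have "\<dots> = h powr p + (p - 1) * t powr p"
    using assms(3) by (simp add: distrib_left)
  finally show ?thesis
    by (simp add: mult.assoc mult.commute mult.left_commute)
qed

lemma powr_mult_self:
  fixes t p :: real
  assumes "0 \<le> t" "1 < p"
  shows "t powr (p - 1) * t = t powr p"
  using assms powr_mult_base[of t "p - 1"] by (simp add: mult.commute)

lemma powr_mean_le:
  fixes a :: "'i \<Rightarrow> real"
  assumes "finite I" "I \<noteq> {}" "\<And>i. i \<in> I \<Longrightarrow> 0 \<le> a i" "1 < p"
  shows "((\<Sum>i\<in>I. a i) / card I) powr p \<le> (\<Sum>i\<in>I. a i powr p) / card I"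
proof -
  define t where "t = (\<Sum>i\<in>I. a i) / card I"
  have c: "card I > 0" using assms by (simp add: card_gt_0_iff)
  have t: "t \<ge> 0" "(\<Sum>i\<in>I. a i) = t * card I"
    using assms c by (auto simp: t_def sum_nonneg)
  have "(\<Sum>i\<in>I. p * t powr (p - 1) * a i) \<le> (\<Sum>i\<in>I. a i powr p + (p - 1) * t powr p)"
    using assms t by (intro sum_mono powr_tangent_line) auto
  also have "(\<Sum>i\<in>I. p * t powr (p - 1) * a i) = p * (t powr (p - 1) * t) * card I"
    by (simp add: sum_distrib_left[symmetric] t(2))
  also have "t powr (p - 1) * t = t powr p"
    using t assms by (simp add: powr_mult_self)
  finally have "t powr p * card I \<le> (\<Sum>i\<in>I. a i powr p)"
    by (simp add: sum.distrib left_diff_distrib)  (simp add: right_diff_distrib mult.left_commute mult.commute)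
  then show ?thesis
    using c by (simp add: t_def field_simps)
qed

text \<open>Write \<open>x powr p\<close> as \<open>x * x powr (p - 1)\<close> and bound the second
  factor by \<open>(a + b) powr (p - 1)\<close>. This is what makes \<open>pmass\<close>
  superadditive and supermultiplicative on nonnegative functions.\<close>

lemma powr_superadditive:
  fixes a b p :: real
  assumes "0 \<le> a" "0 \<le> b" "1 \<le> p"
  shows "a powr p + b powr p \<le> (a + b) powr p"
proof (cases "a + b = 0")
  case True
  then have "a = 0" "b = 0" using assms by auto
  then show ?thesis using assms by simp
next
  case False
  then have s: "a + b > 0" using assms by simp
  have *: "x powr p \<le> x * (a + b) powr (p - 1)" if "0 \<le> x" "x \<le> a + b" for x
  proof (cases "x = 0")
    case False
    then have "x powr p = x * x powr (p - 1)"
      using that by (simp add: powr_mult_base)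
    also have "\<dots> \<le> x * (a + b) powr (p - 1)"
      using that assms by (intro mult_left_mono powr_mono2) auto
    finally show ?thesis .
  qed auto
  have "a powr p + b powr p \<le> (a + b) * (a + b) powr (p - 1)"
    using *[of a] *[of b] assms by (simp add: distrib_right)
  also have "\<dots> = (a + b) powr p"
    using s by (simp add: powr_mult_base)
  finally show ?thesis .
qed

lemma powr_add_le:
  fixes a b p :: real
  assumes "0 \<le> a" "0 \<le> b" "0 \<le> p"
  shows "(a + b) powr p \<le> 2 powr p * (a powr p + b powr p)"
proof -
  have "(a + b) powr p \<le> (2 * max a b) powr p"
    using assms by (intro powr_mono2) auto
  also have "\<dots> = 2 powr p * max a b powr p"
    using assms by (simp add: powr_mult)
  also have "\<dots> \<le> 2 powr p * (a powr p + b powr p)"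
    by (intro mult_left_mono) (auto simp: max_def)
  finally show ?thesis .
qed

section \<open>Convolution of finitely supported functions\<close>

text \<open>
  The product of \<open>'a \<Rightarrow>\<^sub>0 real\<close> is the convolution with respect to the counting measure.
\<close>

abbreviation "lookup \<equiv> Poly_Mapping.lookup"
abbreviation "keys \<equiv> Poly_Mapping.keys"

definition pm_nonneg :: "('a \<Rightarrow>\<^sub>0 real) \<Rightarrow> bool" where
  "pm_nonneg f \<longleftrightarrow> (\<forall>x. 0 \<le> lookup f x)"

text \<open>The p-th power of the l^p norm when \<open>f\<close> is nonnegative; without the p-th
  root, superadditivity of powers passes directly to sums of functions.\<close>

definition pmass :: "real \<Rightarrow> ('a \<Rightarrow>\<^sub>0 real) \<Rightarrow> real" where
  "pmass p f = (\<Sum>x\<in>keys f. lookup f x powr p)"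

lemma pmass_eq_sum:
  assumes "finite A" "keys f \<subseteq> A"
  shows "pmass p f = (\<Sum>x\<in>A. lookup f x powr p)"
  unfolding pmass_def
  by (rule sum.mono_neutral_left) (use assms in \<open>auto simp: in_keys_iff\<close>)

lemma sum_le_pmass:
  assumes "finite A"
  shows "(\<Sum>x\<in>A. lookup f x powr p) \<le> pmass p f"
proof -
  have "(\<Sum>x\<in>A. lookup f x powr p) \<le> (\<Sum>x\<in>A \<union> keys f. lookup f x powr p)"
    using assms by (intro sum_mono2) auto
  also have "\<dots> = pmass p f"
    by (rule pmass_eq_sum[symmetric]) (use assms in auto)
  finally show ?thesis .
qed

lemma pmass_nonneg: "0 \<le> pmass p f"
  unfolding pmass_def by (intro sum_nonneg) auto

lemma pmass_mono:
  assumes "\<And>x. 0 \<le> lookup f x" "\<And>x. lookup f x \<le> lookup g x" "0 \<le> p"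
  shows "pmass p f \<le> pmass p g"
proof -
  let ?A = "keys f \<union> keys g"
  have "pmass p f = (\<Sum>x\<in>?A. lookup f x powr p)"
    by (rule pmass_eq_sum) auto
  also have "\<dots> \<le> (\<Sum>x\<in>?A. lookup g x powr p)"
    using assms by (intro sum_mono powr_mono2) auto
  also have "\<dots> = pmass p g"
    by (rule pmass_eq_sum[symmetric]) auto
  finally show ?thesis .
qed

lemma lookup_times_eq_sum:
  fixes f g :: "'a::group_add \<Rightarrow>\<^sub>0 real"
  shows "lookup (f * g) x = (\<Sum>y\<in>keys f. lookup f y * lookup g (- y + x))"
proof -
  have *: "(\<Sum>q. lookup g q when x = l + q) = lookup g (- l + x)" for l
  proof -
    have "(\<lambda>q. lookup g q when x = l + q) = (\<lambda>q. lookup g q when q = - l + x)"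
      by (rule ext, rule when_cong) (auto simp: algebra_simps add.assoc[symmetric])
    then show ?thesis by (simp only: Sum_any_when_equal)
  qed
  have "lookup (f * g) x = (\<Sum>l. lookup f l * lookup g (- l + x))"
    by (simp add: lookup_mult *)
  also have "\<dots> = (\<Sum>y\<in>keys f. lookup f y * lookup g (- y + x))"
    by (rule Sum_any.expand_superset) (auto simp: in_keys_iff)
  finally show ?thesis .
qed

lemma lookup_single_times:
  fixes g :: "'a::group_add \<Rightarrow>\<^sub>0 real"
  shows "lookup (Poly_Mapping.single y c * g) x = c * lookup g (- y + x)"
  by (cases "c = 0") (simp_all add: lookup_times_eq_sum)

lemma poly_mapping_eq_sum_single:
  fixes f :: "'a \<Rightarrow>\<^sub>0 real"
  shows "f = (\<Sum>y\<in>keys f. Poly_Mapping.single y (lookup f y))"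
proof (rule poly_mapping_eqI)
  fix k
  have "lookup (\<Sum>y\<in>keys f. Poly_Mapping.single y (lookup f y)) k
      = (\<Sum>y\<in>keys f. if y = k then lookup f y else 0)"
    by (simp add: lookup_sum lookup_single when_def)
  also have "\<dots> = lookup f k"
    by (auto simp: in_keys_iff)
  finally show "lookup f k = lookup (\<Sum>y\<in>keys f. Poly_Mapping.single y (lookup f y)) k" ..
qed

lemma pm_nonneg_mult:
  fixes f g :: "'a::group_add \<Rightarrow>\<^sub>0 real"
  shows "pm_nonneg f \<Longrightarrow> pm_nonneg g \<Longrightarrow> pm_nonneg (f * g)"
  by (auto simp: pm_nonneg_def lookup_times_eq_sum intro!: sum_nonneg)

lemma pm_nonneg_sum: "(\<And>i. i \<in> I \<Longrightarrow> pm_nonneg (u i)) \<Longrightarrow> pm_nonneg (\<Sum>i\<in>I. u i)"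
  by (auto simp: pm_nonneg_def lookup_sum intro!: sum_nonneg)

lemma pm_nonneg_add: "pm_nonneg f \<Longrightarrow> pm_nonneg g \<Longrightarrow> pm_nonneg (f + g)"
  by (auto simp: pm_nonneg_def lookup_add)

lemma pm_nonneg_one: "pm_nonneg 1"
  by (auto simp: pm_nonneg_def lookup_one when_def)

lemma pm_nonneg_power:
  fixes f :: "'a::group_add \<Rightarrow>\<^sub>0 real"
  shows "pm_nonneg f \<Longrightarrow> pm_nonneg (f ^ n)"
  by (induction n) (auto simp: pm_nonneg_one pm_nonneg_mult)

lemma pmass_one: "pmass p 1 = 1"
  by (simp add: pmass_def)

lemma pmass_add_ge:
  assumes "pm_nonneg f" "pm_nonneg g" "1 \<le> p"
  shows "pmass p f + pmass p g \<le> pmass p (f + g)"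
proof -
  let ?A = "keys f \<union> keys g"
  have "pmass p f + pmass p g = (\<Sum>x\<in>?A. lookup f x powr p + lookup g x powr p)"
    by (simp add: sum.distrib pmass_eq_sum[of ?A f] pmass_eq_sum[of ?A g])
  also have "\<dots> \<le> (\<Sum>x\<in>?A. lookup (f + g) x powr p)"
    using assms by (intro sum_mono) (auto simp: pm_nonneg_def lookup_add intro: powr_superadditive)
  also have "\<dots> = pmass p (f + g)"
    by (rule pmass_eq_sum[symmetric]) (use keys_add[of f g] in auto)
  finally show ?thesis .
qed

lemma pmass_add_le:
  assumes "pm_nonneg f" "pm_nonneg g" "0 \<le> p"
  shows "pmass p (f + g) \<le> 2 powr p * (pmass p f + pmass p g)"
proof -
  let ?A = "keys f \<union> keys g"
  have "pmass p (f + g) = (\<Sum>x\<in>?A. lookup (f + g) x powr p)"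
    by (rule pmass_eq_sum) (use keys_add[of f g] in auto)
  also have "\<dots> \<le> (\<Sum>x\<in>?A. 2 powr p * (lookup f x powr p + lookup g x powr p))"
    using assms by (intro sum_mono) (auto simp: pm_nonneg_def lookup_add intro: powr_add_le)
  also have "\<dots> = 2 powr p * (pmass p f + pmass p g)"
    by (simp add: sum.distrib sum_distrib_left[symmetric] pmass_eq_sum[of ?A f] pmass_eq_sum[of ?A g])
  finally show ?thesis .
qed

lemma pmass_sum_ge:
  assumes "finite I" "\<And>i. i \<in> I \<Longrightarrow> pm_nonneg (u i)" "1 \<le> p"
  shows "(\<Sum>i\<in>I. pmass p (u i)) \<le> pmass p (\<Sum>i\<in>I. u i)"
  using assms(1,2)
proof (induction I rule: finite_induct)
  case empty
  then show ?case by (simp add: pmass_def)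
next
  case (insert i I)
  have "pmass p (u i) + pmass p (sum u I) \<le> pmass p (u i + sum u I)"
    using insert assms(3) by (intro pmass_add_ge pm_nonneg_sum) auto
  with insert show ?case by fastforce
qed

text \<open>A point mass at \<open>y\<close> acts on the left as translation by \<open>y\<close> and
  scaling by \<open>c\<close>, and translation only permutes the summands.\<close>

lemma pmass_single_times:
  fixes g :: "'a::group_add \<Rightarrow>\<^sub>0 real"
  assumes "0 \<le> c" "pm_nonneg g"
  shows "pmass p (Poly_Mapping.single y c * g) = c powr p * pmass p g"
proof -
  have "pmass p (Poly_Mapping.single y c * g)
      = (\<Sum>x\<in>(+) y ` keys g. lookup (Poly_Mapping.single y c * g) x powr p)"
    by (rule pmass_eq_sum)
       (auto simp: in_keys_iff lookup_single_times image_iff intro: exI[where x="- y + x" for x]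
             intro!: bexI[where x="- y + x" for x] simp: add.assoc[symmetric])
  also have "\<dots> = (\<Sum>x\<in>keys g. (c * lookup g x) powr p)"
    by (subst sum.reindex) (auto simp: inj_on_def lookup_single_times add.assoc[symmetric])
  also have "\<dots> = c powr p * pmass p g"
    using assms by (simp add: pmass_def sum_distrib_left powr_mult pm_nonneg_def)
  finally show ?thesis .
qed

lemma pmass_scale:
  fixes f :: "'a::group_add \<Rightarrow>\<^sub>0 real"
  assumes "0 \<le> c" "pm_nonneg f"
  shows "pmass p (Poly_Mapping.single 0 c * f) = c powr p * pmass p f"
  using assms by (rule pmass_single_times)

text \<open>The product is the sum of the scaled left translates
  \<open>single y (lookup f y) * g\<close>. Their masses add up to
  \<open>pmass p f * pmass p g\<close>, and \<open>pmass\<close> is superadditive.\<close>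

lemma pmass_mult_ge:
  fixes f g :: "'a::group_add \<Rightarrow>\<^sub>0 real"
  assumes "pm_nonneg f" "pm_nonneg g" "1 \<le> p"
  shows "pmass p f * pmass p g \<le> pmass p (f * g)"
proof -
  let ?u = "\<lambda>y. Poly_Mapping.single y (lookup f y) * g"
  have "pmass p f * pmass p g = (\<Sum>y\<in>keys f. pmass p (?u y))"
    using assms by (simp add: pmass_single_times pm_nonneg_def pmass_def[of p f] sum_distrib_right)
  also have "\<dots> \<le> pmass p (\<Sum>y\<in>keys f. ?u y)"
    using assms by (intro pmass_sum_ge pm_nonneg_mult) (auto simp: pm_nonneg_def lookup_single when_def)
  also have "(\<Sum>y\<in>keys f. ?u y) = f * g"
    by (metis poly_mapping_eq_sum_single sum_distrib_right)
  finally show ?thesis .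
qed

text \<open>Scalars are encoded as point masses at \<open>0\<close>, so that scaling is itself a
  product. Being central, they can be collected in powers although the group may be
  noncommutative.\<close>

lemma single_zero_commute:
  fixes f :: "'a::group_add \<Rightarrow>\<^sub>0 real"
  shows "f * Poly_Mapping.single 0 c = Poly_Mapping.single 0 c * f"
proof (rule poly_mapping_eqI)
  fix x
  have "(0 = - y + x) = (y = x)" for y :: 'a
    using neg_eq_iff_add_eq_0[of "- y" x] by auto
  then have "lookup (f * Poly_Mapping.single 0 c) x = (\<Sum>y\<in>keys f. if y = x then lookup f y * c else 0)"
    unfolding lookup_times_eq_sum lookup_single when_def by (intro sum.cong) auto
  also have "\<dots> = c * lookup f x"
    by (auto simp: in_keys_iff)
  finally show "lookup (f * Poly_Mapping.single 0 c) x = lookup (Poly_Mapping.single 0 c * f) x"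
    by (simp add: lookup_single_times)
qed

lemma scaled_power:
  fixes f :: "'a::group_add \<Rightarrow>\<^sub>0 real"
  shows "(Poly_Mapping.single 0 c * f) ^ n = Poly_Mapping.single 0 (c ^ n) * f ^ n"
proof (induction n)
  case (Suc n)
  have "(Poly_Mapping.single 0 c * f) ^ Suc n
      = Poly_Mapping.single 0 c * (f * Poly_Mapping.single 0 (c ^ n)) * f ^ n"
    by (simp add: Suc mult.assoc)
  also have "\<dots> = (Poly_Mapping.single 0 c * Poly_Mapping.single 0 (c ^ n)) * (f * f ^ n)"
    by (simp only: single_zero_commute[of f "c ^ n"] mult.assoc)
  finally show ?case
    by (simp add: mult_single)
qed simp

section \<open>Discrete groups whose l^p norm is submultiplicative up to a constant\<close>

locale lp_convolution_algebra =
  fixes p K :: real and ty :: "'a::group_add itself"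
  assumes p_gt1: "1 < p" and K_ge1: "1 \<le> K"
    and pmass_mult_le: "\<And>f g :: 'a \<Rightarrow>\<^sub>0 real. pm_nonneg f \<Longrightarrow> pm_nonneg g \<Longrightarrow>
      pmass p (f * g) \<le> K * pmass p f * pmass p g"
begin

text \<open>
  The powers grow exactly exponentially, up to the factor \<open>K\<close>, because \<^const>\<open>pmass\<close> is not only
  submultiplicative up to \<open>K\<close> but also supermultiplicative on nonnegative functions.
\<close>

lemma pmass_growth_rate:
  fixes f :: "'a \<Rightarrow>\<^sub>0 real"
  assumes "pm_nonneg f" "0 < pmass p f"
  obtains R where "0 < R" "\<And>n. pmass p (f ^ n) \<le> R ^ n" "\<And>n. R ^ n \<le> K * pmass p (f ^ n)"
proof -
  define a where "a n = pmass p (f ^ n)" for n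
  have nn: "pm_nonneg (f ^ n)" for n
    using assms pm_nonneg_power by blast
  have up: "a (m + n) \<le> K * a m * a n" for m n
    unfolding a_def power_add by (intro pmass_mult_le nn)
  have low: "a m * a n \<le> a (m + n)" for m n
    unfolding a_def power_add by (intro pmass_mult_ge nn) (use p_gt1 in auto)
  have a0: "a 0 = 1" by (simp add: a_def pmass_one)
  have a1: "a 1 > 0" using assms by (simp add: a_def)
  have pos: "a n > 0" for n
  proof (induction n)
    case (Suc n)
    have "0 < a 1 * a n" using a1 Suc by simp
    also have "\<dots> \<le> a (Suc n)" using low[of 1 n] by simp
    finally show ?case .
  qed (simp add: a0)
  have up_pow: "a (n * m) \<le> (K * a n) ^ m" for n m
  proof (induction m)
    case (Suc m)
    have "a (n * Suc m) \<le> K * a n * a (n * m)" using up[of n "n * m"] by simp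
    also have "\<dots> \<le> K * a n * (K * a n) ^ m"
      using Suc K_ge1 pos[of n] by (intro mult_left_mono) auto
    finally show ?case by simp
  qed (simp add: a0)
  have low_pow: "a n ^ m \<le> a (n * m)" for n m
  proof (induction m)
    case (Suc m)
    have "a n ^ Suc m \<le> a n * a (n * m)"
      using Suc pos[of n] by simp
    also have "\<dots> \<le> a (n * Suc m)" using low[of n "n * m"] by simp
    finally show ?case .
  qed (simp add: a0)
  \<comment> \<open>Both sides are compared through \<open>a (m * n)\<close>: the m-th root of
    \<open>a m\<close> lies below the n-th root of \<open>K * a n\<close> for all \<open>m\<close>,
    \<open>n\<close>, and the supremum \<open>R\<close> of the former separates the two
    families.\<close>
  have root_le: "a m powr (1 / m) \<le> (K * a n) powr (1 / n)" if "m \<ge> 1" "n \<ge> 1" for m n :: nat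
  proof -
    have "a m ^ n \<le> (K * a n) ^ m"
      using low_pow[of m n] up_pow[of n m] by (simp add: mult.commute)
    then have "(a m ^ n) powr (1 / (m * n)) \<le> ((K * a n) ^ m) powr (1 / (m * n))"
      using pos[of m] by (intro powr_mono2) auto
    moreover have "(a m ^ n) powr (1 / (m * n)) = a m powr (1 / m)"
      using that pos[of m] by (simp add: powr_realpow[symmetric] powr_powr)
    moreover have "((K * a n) ^ m) powr (1 / (m * n)) = (K * a n) powr (1 / n)"
      using that pos[of n] K_ge1 by (simp add: powr_realpow[symmetric] powr_powr)
    ultimately show ?thesis by simp
  qed
  define X where "X = (\<lambda>m::nat. a m powr (1 / m)) ` {1..}"
  have X: "X \<noteq> {}" "bdd_above X"
    using root_le[of _ 1] by (auto simp: X_def intro!: bdd_aboveI)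
  define R where "R = Sup X"
  have R_ge: "a m powr (1 / m) \<le> R" if "m \<ge> 1" for m :: nat
    unfolding R_def by (rule cSup_upper) (use that X in \<open>auto simp: X_def\<close>)
  have R_le: "R \<le> (K * a n) powr (1 / n)" if "n \<ge> 1" for n :: nat
    unfolding R_def by (rule cSup_least) (use that X root_le in \<open>auto simp: X_def\<close>)
  have R_pos: "R > 0" using R_ge[of 1] a1 by simp
  have pw: "(x powr (1 / n)) ^ n = x" if "x > 0" "n \<ge> 1" for x :: real and n :: nat
    using that by (simp add: powr_powr flip: powr_realpow)
  show thesis
  proof (rule that[OF R_pos])
    fix n
    show "pmass p (f ^ n) \<le> R ^ n"
    proof (cases "n \<ge> 1")
      case True
      then have "a n = (a n powr (1 / n)) ^ n" using pw pos by simp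
      also have "\<dots> \<le> R ^ n" using R_ge[OF True] by (intro power_mono) auto
      finally show ?thesis by (simp add: a_def)
    qed (use a0 in \<open>auto simp: a_def not_le\<close>)
    show "R ^ n \<le> K * pmass p (f ^ n)"
    proof (cases "n \<ge> 1")
      case True
      have "R ^ n \<le> ((K * a n) powr (1 / n)) ^ n"
        using R_le[OF True] R_pos by (intro power_mono) auto
      also have "\<dots> = K * a n" using pw True pos[of n] K_ge1 by simp
      finally show ?thesis by (simp add: a_def)
    qed (use a0 K_ge1 in \<open>auto simp: a_def not_le\<close>)
  qed
qed

lemma normalized_powers:
  fixes f :: "'a \<Rightarrow>\<^sub>0 real"
  assumes "pm_nonneg f" "0 < pmass p f"
  obtains c where "0 < c" "\<And>n. pmass p ((Poly_Mapping.single 0 c * f) ^ n) \<le> 1"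
    "\<And>n. 1 \<le> K * pmass p ((Poly_Mapping.single 0 c * f) ^ n)"
proof -
  obtain R where R: "0 < R" "\<And>n. pmass p (f ^ n) \<le> R ^ n" "\<And>n. R ^ n \<le> K * pmass p (f ^ n)"
    using pmass_growth_rate[OF assms] by metis
  \<comment> \<open>\<open>pmass p\<close> is homogeneous of degree \<open>p\<close>, so scaling by
    \<open>c ^ n\<close> divides it by \<open>R ^ n\<close>.\<close>
  define c where "c = R powr (- 1 / p)"
  have "c > 0" using R by (simp add: c_def)
  have "(c ^ n) powr p = inverse (R ^ n)" for n
  proof -
    have "(c ^ n) powr p = (c powr p) ^ n"
      using \<open>c > 0\<close> by (simp add: powr_powr mult.commute flip: powr_realpow)
    also have "c powr p = inverse R"
      using R p_gt1 by (simp add: c_def powr_powr flip: powr_minus_divide)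
        (simp add: inverse_eq_divide)
    finally show ?thesis by (simp add: power_inverse)
  qed
  then have *: "pmass p ((Poly_Mapping.single 0 c * f) ^ n) = pmass p (f ^ n) / R ^ n" for n
    using assms \<open>c > 0\<close> by (simp add: scaled_power pmass_scale pm_nonneg_power divide_inverse)
  show thesis
    by (rule that[OF \<open>c > 0\<close>]) (use R in \<open>auto simp: * field_simps\<close>)
qed

context
  fixes h :: "'a \<Rightarrow>\<^sub>0 real"
  assumes h_nonneg: "pm_nonneg h"
    and h_le: "\<And>n. pmass p (h ^ n) \<le> 1"
    and h_ge: "\<And>n. 1 \<le> K * pmass p (h ^ n)"
begin

lemma pm_nonneg_powers: "pm_nonneg (\<Sum>n\<leftarrow>ns. h ^ n)"
  by (induction ns) (auto intro!: pm_nonneg_add pm_nonneg_power h_nonneg, simp add: pm_nonneg_def)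

text \<open>The next power is chosen small on the support of the current sum \<open>F\<close>: there
  it raises the mass by less than 1, and off the support it contributes at most its own mass, which
  is at most 1. The exponents form a list since they need not be distinct.\<close>

lemma almost_disjoint_powers:
  assumes esc: "\<And>E \<delta>. finite E \<Longrightarrow> \<delta> > 0 \<Longrightarrow> \<exists>n. \<forall>x\<in>E. lookup (h ^ n) x < \<delta>"
  shows "\<exists>ns. length ns = M \<and> pmass p (\<Sum>n\<leftarrow>ns. h ^ n) \<le> 2 * M"
proof (induction M)
  case 0
  then show ?case by (simp add: pmass_def)
next
  case (Suc M)
  then obtain ns where ns: "length ns = M" "pmass p (\<Sum>n\<leftarrow>ns. h ^ n) \<le> 2 * M"
    by blast
  define F where "F = (\<Sum>n\<leftarrow>ns. h ^ n)"
  have F: "pm_nonneg F" unfolding F_def by (rule pm_nonneg_powers)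
  define E where "E = keys F"
  \<comment> \<open>Continuity in \<open>\<delta>\<close> over the finite set \<open>E\<close>,
    where \<open>lookup F\<close> is nonzero, yields a perturbation that costs mass less than
    1.\<close>
  have "((\<lambda>\<delta>. \<Sum>x\<in>E. (lookup F x + \<delta>) powr p) \<longlongrightarrow> (\<Sum>x\<in>E. (lookup F x + 0) powr p)) (at_right 0)"
    by (intro tendsto_sum tendsto_powr tendsto_intros) (auto simp: E_def in_keys_iff)
  then have "((\<lambda>\<delta>. \<Sum>x\<in>E. (lookup F x + \<delta>) powr p) \<longlongrightarrow> pmass p F) (at_right 0)"
    by (simp add: pmass_def E_def)
  then have "\<forall>\<^sub>F \<delta> in at_right 0. (\<Sum>x\<in>E. (lookup F x + \<delta>) powr p) < pmass p F + 1"
    by (rule order_tendstoD) simp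
  moreover have "\<forall>\<^sub>F \<delta> in at_right (0::real). \<delta> > 0"
    by (simp add: eventually_at_right_less)
  ultimately have "\<forall>\<^sub>F \<delta> in at_right 0. (\<Sum>x\<in>E. (lookup F x + \<delta>) powr p) < pmass p F + 1 \<and> \<delta> > 0"
    by (rule eventually_conj)
  then obtain \<delta> where \<delta>: "(\<Sum>x\<in>E. (lookup F x + \<delta>) powr p) < pmass p F + 1" "\<delta> > 0"
    by (metis (no_types, lifting) eventually_happens trivial_limit_at_right_real)
  obtain n where n: "\<And>x. x \<in> E \<Longrightarrow> lookup (h ^ n) x < \<delta>"
    using esc[of E \<delta>] \<delta> by (auto simp: E_def)
  have hn: "pm_nonneg (h ^ n)" by (intro pm_nonneg_power h_nonneg)
  let ?D = "keys (h ^ n) - E"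
  have "pmass p (h ^ n + F) = (\<Sum>x\<in>E \<union> ?D. lookup (h ^ n + F) x powr p)"
    by (rule pmass_eq_sum) (use keys_add[of "h ^ n" F] in \<open>auto simp: E_def\<close>)
  also have "\<dots> = (\<Sum>x\<in>E. lookup (h ^ n + F) x powr p) + (\<Sum>x\<in>?D. lookup (h ^ n + F) x powr p)"
    by (rule sum.union_disjoint) (auto simp: E_def)
  also have "(\<Sum>x\<in>?D. lookup (h ^ n + F) x powr p) = (\<Sum>x\<in>?D. lookup (h ^ n) x powr p)"
    by (intro sum.cong) (auto simp: lookup_add E_def in_keys_iff)
  also have "\<dots> \<le> pmass p (h ^ n)"
    by (rule sum_le_pmass) auto
  also have "\<dots> \<le> 1" by (rule h_le)
  also have "(\<Sum>x\<in>E. lookup (h ^ n + F) x powr p) \<le> (\<Sum>x\<in>E. (lookup F x + \<delta>) powr p)"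
    using F hn n p_gt1 less_imp_le[OF n]
    by (intro sum_mono powr_mono2) (auto simp: lookup_add pm_nonneg_def)
  also have "\<dots> \<le> 2 * M + 1"
    using \<delta> ns by (simp add: F_def)
  finally have "pmass p (\<Sum>n\<leftarrow>n # ns. h ^ n) \<le> 2 * Suc M"
    by (simp add: F_def)
  then show ?case
    using ns by (intro exI[of _ "n # ns"]) auto
qed

text \<open>
  Otherwise one could add up \<open>M\<close> almost disjoint powers to an \<open>F\<close> with \<open>pmass p F \<le> 2 M\<close>. But \<open>F\<close>
  acts on the partial sums \<open>W L\<close> of the powers almost as multiplication by \<open>M\<close>, so that \<open>M\<^sup>p\<close> would
  grow at most linearly in \<open>M\<close>.
\<close>

lemma powers_do_not_escape:
  "\<exists>E \<delta>. finite E \<and> \<delta> > 0 \<and> (\<forall>n. \<exists>x\<in>E. lookup (h ^ n) x \<ge> \<delta>)"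
proof (rule ccontr)
  assume neg: "\<not> ?thesis"
  have esc: "\<exists>n. \<forall>x\<in>E. lookup (h ^ n) x < \<delta>" if "finite E" "\<delta> > 0" for E \<delta>
  proof (rule ccontr)
    assume "\<not> (\<exists>n. \<forall>x\<in>E. lookup (h ^ n) x < \<delta>)"
    then have "\<forall>n. \<exists>x\<in>E. lookup (h ^ n) x \<ge> \<delta>" by (simp add: not_less)
    with that neg show False by blast
  qed
  define W where "W L = (\<Sum>n<L. h ^ n)" for L :: nat
  have W_nonneg: "pm_nonneg (W L)" for L
    unfolding W_def by (intro pm_nonneg_sum pm_nonneg_power h_nonneg)
  \<comment> \<open>Multiplication by \<open>h ^ n\<close> shifts the partial sum;
    \<open>W n\<close> restores the first \<open>n\<close> terms that are lost.\<close>
  have shift: "h ^ n * W L + W n = W (L + n)" for n L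
  proof -
    have "h ^ n * W L = (\<Sum>i<L. h ^ (n + i))"
      by (simp add: W_def sum_distrib_left power_add)
    moreover have "(\<Sum>i<L. h ^ (n + i)) + W n = W (L + n)"
      by (induction L) (simp_all add: W_def add.commute add.left_commute)
    ultimately show ?thesis by simp
  qed
  have W_ge: "real L \<le> K * pmass p (W L)" for L
  proof -
    have "real L = (\<Sum>n<L. 1)" by simp
    also have "\<dots> \<le> (\<Sum>n<L. K * pmass p (h ^ n))" by (intro sum_mono h_ge)
    also have "\<dots> = K * (\<Sum>n<L. pmass p (h ^ n))" by (simp add: sum_distrib_left)
    also have "\<dots> \<le> K * pmass p (W L)"
      unfolding W_def using K_ge1 p_gt1
      by (intro mult_left_mono pmass_sum_ge pm_nonneg_power h_nonneg) auto
    finally show ?thesis .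
  qed
  have bound: "real M powr p \<le> 2 powr p * (2 * K * M + 1)" for M :: nat
  proof -
    obtain ns where ns: "length ns = M" "pmass p (\<Sum>n\<leftarrow>ns. h ^ n) \<le> 2 * M"
      using almost_disjoint_powers[OF esc] by blast
    define F where "F = (\<Sum>n\<leftarrow>ns. h ^ n)"
    \<comment> \<open>\<open>V\<close> collects the terms lost under the powers in \<open>F\<close>;
      it does not depend on \<open>L\<close>.\<close>
    define V where "V = (\<Sum>n\<leftarrow>ns. W n)"
    have F: "pm_nonneg F" unfolding F_def by (rule pm_nonneg_powers)
    have V: "pm_nonneg V"
      unfolding V_def by (induction ns) (auto intro!: pm_nonneg_add W_nonneg, simp add: pm_nonneg_def)
    have eq: "F * W L + V = (\<Sum>n\<leftarrow>ns. W (L + n))" for L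
      unfolding F_def V_def
    proof (induction ns)
      case (Cons n ns)
      have *: "(h ^ n + F) * W L + (W n + V) = (h ^ n * W L + W n) + (F * W L + V)" for F V
        by (simp add: distrib_right add.commute add.left_commute)
      show ?case
        by (simp only: list.map sum_list.Cons * shift Cons.IH)
    qed simp
    \<comment> \<open>The mass of \<open>W L\<close> is at least \<open>L / K\<close>, so for this
      \<open>L\<close> the fixed defect \<open>V\<close> has at most the mass of
      \<open>W L\<close>.\<close>
    define L where "L = nat \<lceil>K * pmass p V\<rceil> + 1"
    have L: "K * pmass p V \<le> L" "L > 0" unfolding L_def by linarith+
    have WV: "pmass p V \<le> pmass p (W L)"
      by (rule mult_left_le_imp_le[of K]) (use L W_ge[of L] K_ge1 in linarith)+
    have Wpos: "pmass p (W L) > 0"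
    proof -
      have "0 < K * pmass p (W L)" using W_ge[of L] L by linarith
      then show ?thesis using K_ge1 by (simp add: zero_less_mult_iff)
    qed
    \<comment> \<open>Each of the \<open>M\<close> summands \<open>W (L + n)\<close> dominates
      \<open>W L\<close> pointwise.\<close>
    have "lookup (Poly_Mapping.single 0 (real M) * W L) x \<le> lookup (F * W L + V) x" for x
    proof -
      have le: "lookup (W L) x \<le> lookup (W (L + n)) x" for n
        using pm_nonneg_power[OF h_nonneg] unfolding W_def lookup_sum
        by (intro sum_mono2) (auto simp: pm_nonneg_def)
      have "real (length ns) * lookup (W L) x \<le> lookup (\<Sum>n\<leftarrow>ns. W (L + n)) x"
      proof (induction ns)
        case (Cons n ns)
        then show ?case using le[of n] by (simp add: lookup_add distrib_right)
      qed simp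
      then show ?thesis
        unfolding eq lookup_single_times by (simp add: ns(1))
    qed
    then have "pmass p (Poly_Mapping.single 0 (real M) * W L) \<le> pmass p (F * W L + V)"
      using W_nonneg[of L] p_gt1
      by (intro pmass_mono) (auto simp: lookup_single_times pm_nonneg_def simp del: single_of_nat)
    also have "\<dots> \<le> 2 powr p * (pmass p (F * W L) + pmass p V)"
      using F V W_nonneg p_gt1 by (intro pmass_add_le pm_nonneg_mult) auto
    also have "\<dots> \<le> 2 powr p * (K * (2 * M) * pmass p (W L) + pmass p (W L))"
    proof (intro mult_left_mono add_mono WV)
      have "pmass p (F * W L) \<le> K * pmass p F * pmass p (W L)"
        by (intro pmass_mult_le F W_nonneg)
      also have "\<dots> \<le> K * (2 * M) * pmass p (W L)"
        using ns K_ge1 by (intro mult_right_mono mult_left_mono) (auto simp: F_def pmass_nonneg)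
      finally show "pmass p (F * W L) \<le> K * (2 * M) * pmass p (W L)" .
    qed auto
    also have "pmass p (Poly_Mapping.single 0 (real M) * W L) = real M powr p * pmass p (W L)"
      by (intro pmass_scale W_nonneg) auto
    finally have "real M powr p * pmass p (W L) \<le> (2 powr p * (2 * K * M + 1)) * pmass p (W L)"
      by (simp add: algebra_simps)
    then show ?thesis using Wpos by (simp only: mult_le_cancel_right_pos)
  qed
  define B where "B = 2 powr p * (2 * K + 1)"
  have B: "B > 0" using K_ge1 by (simp add: B_def)
  \<comment> \<open>As \<open>p > 1\<close>, a large \<open>M\<close> gives
    \<open>M powr (p - 1) > B\<close>, so that \<open>M powr p\<close> exceeds the linear bound
    \<open>M * B\<close>.\<close>
  define M where "M = nat \<lceil>B powr (1 / (p - 1))\<rceil> + 1"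
  have M: "real M > B powr (1 / (p - 1))" "real M \<ge> 1" unfolding M_def by linarith+
  have "real M * B < real M * real M powr (p - 1)"
  proof -
    have "B = (B powr (1 / (p - 1))) powr (p - 1)"
      using B p_gt1 by (simp add: powr_powr)
    also have "\<dots> < real M powr (p - 1)"
      using M p_gt1 by (intro powr_less_mono2) auto
    finally show ?thesis using M by simp
  qed
  also have "\<dots> = real M powr p"
    using M by (simp add: powr_mult_base)
  also have "\<dots> \<le> 2 powr p * (2 * K * M + M)"
    using M by (intro order_trans[OF bound[of M]] mult_left_mono) auto
  also have "\<dots> = real M * B" by (simp add: B_def algebra_simps)
  finally show False by simp
qed

end

end

section \<open>Generated subgroups and positive eigenfunctions\<close>

inductive_set additive_closure :: "'a::monoid_add set \<Rightarrow> 'a set" for S where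
  zero: "0 \<in> additive_closure S"
| step: "s \<in> S \<Longrightarrow> x \<in> additive_closure S \<Longrightarrow> s + x \<in> additive_closure S"

lemma additive_closure_base: "s \<in> S \<Longrightarrow> s \<in> additive_closure S"
  using additive_closure.step[of s S 0] additive_closure.zero[of S] by simp

lemma additive_closure_add:
  assumes "x \<in> additive_closure S" "y \<in> additive_closure S"
  shows "x + y \<in> additive_closure S"
  using assms(1) by induction (auto simp: assms(2) add.assoc intro: additive_closure.step)

text \<open>The inverse of a word is the reversed word of inverses. Together with
  \<open>additive_closure_add\<close> this makes the closure of a symmetric \<open>S\<close> the
  subgroup generated by \<open>S\<close>.\<close>

lemma additive_closure_uminus:
  fixes x :: "'a::group_add"
  assumes "uminus ` S = S" "x \<in> additive_closure S"
  shows "- x \<in> additive_closure S"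
  using assms(2)
proof induction
  case zero
  then show ?case by (simp add: additive_closure.zero)
next
  case (step s x)
  have "- s \<in> additive_closure S"
    using step assms(1) by (intro additive_closure_base) auto
  with step show ?case
    using additive_closure_add[of "- x" S "- s"] by (simp add: minus_add)
qed

lemma has_sum_finite_sum:
  fixes f :: "'i \<Rightarrow> 'b \<Rightarrow> 'c::{topological_comm_monoid_add}"
  assumes "finite I" "\<And>i. i \<in> I \<Longrightarrow> (f i has_sum a i) A"
  shows "((\<lambda>x. \<Sum>i\<in>I. f i x) has_sum (\<Sum>i\<in>I. a i)) A"
  using assms by (induction I rule: finite_induct) (auto intro: has_sum_add)

text \<open>
  A Perron--Frobenius argument: the operator \<open>T\<close> below is symmetric, so pairing the superharmonic
  function \<open>min q (b * q (\<cdot> + y))\<close> with \<open>q\<close> in \<open>\<ell>\<^sup>2\<close> shows that it is harmonic. Hence right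
  translation only multiplies \<open>q\<close> by constants, and \<open>q\<close> is a multiplicative character, which does
  not vanish at infinity. The assumption \<open>p \<le> 2\<close> places \<open>q\<close> in \<open>\<ell>\<^sup>2\<close>.
\<close>

lemma positive_eigenfunction_not_power_summable:
  fixes q :: "'a::group_add \<Rightarrow> real" and S :: "'a set"
  assumes S: "finite S" "uminus ` S = S" and inf: "infinite (additive_closure S)"
    and p: "0 < p" "p \<le> 2"
    and q_nonneg: "\<And>x. 0 \<le> q x"
    and q_sum: "\<And>E. finite E \<Longrightarrow> (\<Sum>x\<in>E. q x powr p) \<le> 1"
    and c: "0 < c"
    and q_eigen: "\<And>x. q x = c * (\<Sum>s\<in>S. q (- s + x))"
    and x0: "x0 \<in> additive_closure S" "0 < q x0"
  shows False
proof -
  let ?H = "additive_closure S"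
  define T where "T v x = c * (\<Sum>s\<in>S. v (- s + x))" for v x
  \<comment> \<open>Minimum principle: at a zero \<open>z\<close> of a nonnegative harmonic function
    all neighbours \<open>- s + z\<close> are zeros too, and left steps by \<open>S\<close> lead
    from \<open>z\<close> to every point of the subgroup.\<close>
  have vanish: "v x = 0"
    if v: "\<And>x. 0 \<le> v x" "\<And>x. x \<in> ?H \<Longrightarrow> T v x = v x" and z: "z \<in> ?H" "v z = 0" and x: "x \<in> ?H"
    for v x z
  proof -
    have "v (w + z) = 0" if "w \<in> ?H" for w
      using that
    proof induction
      case (step s w)
      have "T v (w + z) = v (w + z)"
        by (intro v additive_closure_add step z)
      then have "(\<Sum>s\<in>S. v (- s + (w + z))) = 0"
        using step c by (simp add: T_def)
      moreover have "- s \<in> S" using S step by auto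
      ultimately have "v (- (- s) + (w + z)) = 0"
        using S v(1) sum_nonneg_eq_0_iff[of S "\<lambda>s. v (- s + (w + z))"] by blast
      then show ?case by (simp add: add.assoc)
    qed (use z in simp)
    from this[of "x + - z"] show ?thesis
      using additive_closure_add[OF x additive_closure_uminus[OF S(2) z(1)]] by (simp add: add.assoc)
  qed
  have Tq: "T q x = q x" for x
    using q_eigen[of x] by (simp add: T_def)
  have q_pos: "0 < q x" if "x \<in> ?H" for x
    using vanish[of q x x0] q_nonneg Tq that x0 by (metis less_eq_real_def less_irrefl)
  have q_le1: "q x \<le> 1" for x
  proof (rule ccontr)
    assume "\<not> q x \<le> 1"
    then have "1 < q x powr p" using p by (simp add: gr_one_powr)
    then show False using q_sum[of "{x}"] by simp
  qed
  have sq: "(\<lambda>x. (q x)\<^sup>2) summable_on UNIV"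
  proof (rule nonneg_bdd_above_summable_on)
    have "(\<Sum>x\<in>E. (q x)\<^sup>2) \<le> 1" if "finite E" for E
    proof -
      have "(q x)\<^sup>2 \<le> q x powr p" for x
        using powr_mono'[OF p(2) q_nonneg q_le1, of x] q_nonneg[of x]
        by (cases "q x = 0") (auto simp: powr_numeral)
      then show ?thesis
        using q_sum[OF that] by (meson order_trans sum_mono)
    qed
    then show "bdd_above (sum (\<lambda>x. (q x)\<^sup>2) ` {F. F \<subseteq> UNIV \<and> finite F})"
      by (intro bdd_aboveI[of _ 1]) auto
  qed auto
  have mult_char: "q x * q y = q 0 * q (x + y)" if y: "y \<in> ?H" and x: "x \<in> ?H" for x y
  proof -
    \<comment> \<open>The factor makes \<open>q\<close> and its right translate
      \<open>b * q (x + y)\<close> agree at \<open>x = 0\<close>, where their differences with the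
      minimum \<open>m\<close> therefore vanish.\<close>
    define b where "b = q 0 / q y"
    have b: "b > 0" "b * q y = q 0"
      using q_pos[OF y] q_pos[OF additive_closure.zero] by (auto simp: b_def)
    define m where "m x = min (q x) (b * q (x + y))" for x
    have m: "0 \<le> m x" "m x \<le> q x" "m x \<le> b * q (x + y)" for x
      using q_nonneg b by (auto simp: m_def)
    \<comment> \<open>Right translations commute with \<open>T\<close>, which is built from left
      translations.\<close>
    have Tqy: "T (\<lambda>x. b * q (x + y)) x = b * q (x + y)" for x
      using q_eigen[of "x + y"] by (simp add: T_def sum_distrib_left add.assoc mult.left_commute)
    have Tmono: "T u x \<le> T v x" if "\<And>x. u x \<le> v x" for u v x
      using c that by (auto simp: T_def intro!: sum_mono)
    have Tm: "T m x \<le> m x" for x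
      using Tmono[of m q x] Tmono[of m "\<lambda>x. b * q (x + y)" x] m Tq Tqy by (simp add: m_def)
    have bij: "bij_betw (\<lambda>x. z + x) UNIV UNIV" for z :: 'a
      by (rule bij_betwI[where g="\<lambda>x. - z + x"]) (auto simp: add.assoc[symmetric])
    have sum1: "(\<lambda>x. q x * m (- s + x)) summable_on UNIV" for s
    proof (rule summable_on_comparison_test)
      have "(\<lambda>x. (q (- s + x))\<^sup>2) summable_on UNIV"
        using summable_on_reindex_bij_betw[OF bij[of "- s"], of "\<lambda>x. (q x)\<^sup>2"] sq by simp
      with sq show "(\<lambda>x. (q x)\<^sup>2 + (q (- s + x))\<^sup>2) summable_on UNIV"
        by (rule summable_on_add)
      show "q x * m (- s + x) \<le> (q x)\<^sup>2 + (q (- s + x))\<^sup>2" for x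
      proof -
        have "q x * m (- s + x) \<le> q x * q (- s + x)"
          using m q_nonneg by (intro mult_left_mono) auto
        also have "\<dots> \<le> 2 * (q x * q (- s + x))"
          using q_nonneg by simp
        also have "\<dots> \<le> (q x)\<^sup>2 + (q (- s + x))\<^sup>2"
          using sum_squares_bound[of "q x" "q (- s + x)"] by simp
        finally show ?thesis .
      qed
    qed (use m q_nonneg in auto)
    define a where "a s = infsum (\<lambda>x. q x * m (- s + x)) UNIV" for s
    have a: "((\<lambda>x. q x * m (- s + x)) has_sum a s) UNIV" for s
      unfolding a_def by (rule has_sum_infsum[OF sum1])
    have a': "((\<lambda>x. q (s + x) * m x) has_sum a s) UNIV" for s
      using a[of s] has_sum_reindex_bij_betw[OF bij[of s], of "\<lambda>x. q x * m (- s + x)" "a s"]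
      by (simp add: add.assoc[symmetric])
    have A1: "((\<lambda>x. q x * T m x) has_sum (c * (\<Sum>s\<in>S. a s))) UNIV"
    proof -
      have "((\<lambda>x. c * (\<Sum>s\<in>S. q x * m (- s + x))) has_sum (c * (\<Sum>s\<in>S. a s))) UNIV"
        by (intro has_sum_cmult_right has_sum_finite_sum S a)
      then show ?thesis by (simp add: T_def sum_distrib_left mult.left_commute)
    qed
    \<comment> \<open>The same sum arises when \<open>T\<close> is moved from \<open>m\<close> to
      \<open>q\<close>: translate by \<open>s\<close> and use the symmetry of
      \<open>S\<close>.\<close>
    have A2: "((\<lambda>x. q x * m x) has_sum (c * (\<Sum>s\<in>S. a s))) UNIV"
    proof -
      have "((\<lambda>x. c * (\<Sum>s\<in>S. q (s + x) * m x)) has_sum (c * (\<Sum>s\<in>S. a s))) UNIV"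
        by (intro has_sum_cmult_right has_sum_finite_sum S a')
      moreover have "(\<Sum>s\<in>S. q (s + x)) = (\<Sum>s\<in>S. q (- s + x))" for x
        using sum.reindex[of uminus S "\<lambda>s. q (s + x)"] S by (simp add: o_def inj_on_def)
      then have "c * (\<Sum>s\<in>S. q (s + x) * m x) = q x * m x" for x
        using q_eigen[of x] by (simp add: sum_distrib_right[symmetric])
      ultimately show ?thesis by simp
    qed
    \<comment> \<open>The nonnegative terms \<open>q x * (m x - T m x)\<close> have sum 0, so they
      all vanish.\<close>
    have diff: "((\<lambda>x. q x * m x + (- 1) * (q x * T m x)) has_sum
        (c * (\<Sum>s\<in>S. a s) + (- 1) * (c * (\<Sum>s\<in>S. a s)))) UNIV"
      by (intro has_sum_add A2 has_sum_cmult_right A1)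
    have "q x * m x + (- 1) * (q x * T m x) = 0" for x
      by (rule nonneg_has_sum_le_0D[OF diff]) (use Tm q_nonneg in \<open>auto intro: mult_left_mono\<close>)
    then have "q x * (m x - T m x) = 0" for x
      by (simp add: algebra_simps)
    then have Tm_eq: "T m x = m x" if "x \<in> ?H" for x
      using q_pos[OF that] by (metis eq_iff_diff_eq_0 less_irrefl mult_eq_0_iff)
    have Tdiff: "T (\<lambda>x. u x - v x) x = T u x - T v x" for u v x
      by (simp add: T_def sum_subtractf right_diff_distrib)
    have m0: "m 0 = q 0" "b * q (0 + y) = m 0"
      using b by (simp_all add: m_def)
    have "q x - m x = 0"
      by (rule vanish[of "\<lambda>x. q x - m x" 0])
         (use m m0 x Tdiff Tq Tm_eq in \<open>auto simp: additive_closure.zero\<close>)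
    moreover have "b * q (x + y) - m x = 0"
      by (rule vanish[of "\<lambda>x. b * q (x + y) - m x" 0])
         (use m m0 x Tdiff Tqy Tm_eq in \<open>auto simp: additive_closure.zero\<close>)
    ultimately have "q x = b * q (x + y)" by simp
    then show ?thesis using q_pos[OF y] by (simp add: b_def field_simps)
  qed
  \<comment> \<open>From \<open>q y * q (- y) = q 0 * q 0\<close>, one of \<open>y\<close> and
    \<open>- y\<close> lies in \<open>A\<close>. Hence \<open>A\<close> is infinite, and already
    \<open>N\<close> of its points violate the bound on sums of p-th powers.\<close>
  define A where "A = {y \<in> ?H. q 0 \<le> q y}"
  have q0: "q 0 > 0" using q_pos additive_closure.zero by blast
  have "?H \<subseteq> A \<union> uminus ` A"
  proof
    fix y assume y: "y \<in> ?H"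
    then have y': "- y \<in> ?H" using S additive_closure_uminus by blast
    have "q (- y) * q y = q 0 * q 0" using mult_char[OF y y'] by simp
    then have "q 0 \<le> q y \<or> q 0 \<le> q (- y)"
      using q_nonneg q0 by (metis mult.commute mult_strict_mono' not_le less_irrefl)
    then show "y \<in> A \<union> uminus ` A"
      using y y' by (auto simp: A_def image_iff intro: bexI[of _ "- y"])
  qed
  then have "infinite A" using inf by (meson finite_UnI finite_imageI finite_subset)
  define N where "N = nat \<lceil>1 / q 0 powr p\<rceil> + 1"
  obtain B where B: "finite B" "card B = N" "B \<subseteq> A"
    using infinite_arbitrarily_large[OF \<open>infinite A\<close>] by blast
  have "real N > 1 / q 0 powr p" unfolding N_def by linarith
  then have "1 < real N * q 0 powr p" using q0 by (simp add: field_simps)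
  also have "\<dots> = (\<Sum>y\<in>B. q 0 powr p)" using B by simp
  also have "\<dots> \<le> (\<Sum>y\<in>B. q y powr p)"
    using B p q0 by (intro sum_mono powr_mono2) (auto simp: A_def)
  also have "\<dots> \<le> 1" using q_sum B by blast
  finally show False by simp
qed

section \<open>Finiteness of the discrete group\<close>

context lp_convolution_algebra
begin

text \<open>The closure condition makes \<open>H\<close> a subgroup, so its indicator
  \<open>f\<close> satisfies \<open>f * f = card H\<close> on \<open>H\<close>. Comparing masses
  gives \<open>card H powr (p + 1) \<le> K * (card H)^2\<close>.\<close>

lemma card_finite_subgroup_le:
  fixes H :: "'a set"
  assumes "finite H" "H \<noteq> {}" and diff: "\<And>x y. x \<in> H \<Longrightarrow> y \<in> H \<Longrightarrow> - y + x \<in> H"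
  shows "real (card H) powr (p - 1) \<le> K"
proof -
  define f :: "'a \<Rightarrow>\<^sub>0 real" where "f = (\<Sum>y\<in>H. Poly_Mapping.single y 1)"
  have look: "lookup f x = (if x \<in> H then 1 else 0)" for x
    using assms(1) by (simp add: f_def lookup_sum lookup_single when_def)
  have keys: "keys f = H" by (auto simp: in_keys_iff look split: if_splits)
  have f: "pm_nonneg f" by (auto simp: pm_nonneg_def look)
  have mass: "pmass p f = card H" by (simp add: pmass_def keys look)
  have pos: "0 < real (card H)" using assms by (simp add: card_gt_0_iff)
  have "lookup (f * f) x = card H" if "x \<in> H" for x
    using diff that by (simp add: lookup_times_eq_sum keys look)
  then have "real (card H) * real (card H) powr p = (\<Sum>x\<in>H. lookup (f * f) x powr p)"
    by simp
  also have "\<dots> \<le> pmass p (f * f)" by (rule sum_le_pmass[OF assms(1)])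
  also have "\<dots> \<le> K * pmass p f * pmass p f" by (intro pmass_mult_le f)
  finally have "real (card H) * real (card H) powr p \<le> real (card H) * (K * real (card H))"
    by (simp add: mass mult_ac)
  then have "real (card H) powr p \<le> K * real (card H)"
    using pos by simp
  also have "real (card H) powr p = real (card H) powr (p - 1) * real (card H)"
    using p_gt1 by (simp add: powr_mult_self)
  finally show ?thesis using pos by simp
qed

lemma finite_group:
  assumes "p \<le> 2"
  shows "finite (UNIV :: 'a set)"
proof (rule ccontr)
  assume inf: "infinite (UNIV :: 'a set)"
  \<comment> \<open>More elements than a finite subgroup can have by
    \<open>card_finite_subgroup_le\<close>, so any \<open>N\<close> elements generate an infinite
    subgroup.\<close>
  define N where "N = nat \<lceil>K powr (1 / (p - 1))\<rceil> + 1"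
  have N: "real N > K powr (1 / (p - 1))" unfolding N_def by linarith
  obtain S0 :: "'a set" where S0: "finite S0" "card S0 = N"
    using infinite_arbitrarily_large[OF inf] by blast
  define S where "S = S0 \<union> uminus ` S0"
  have S: "finite S" "uminus ` S = S" "S0 \<subseteq> S"
    using S0 by (auto simp: S_def image_Un image_image)
  let ?H = "additive_closure S"
  have inf_H: "infinite ?H"
  proof
    assume fin: "finite ?H"
    have "- y + x \<in> ?H" if "x \<in> ?H" "y \<in> ?H" for x y
      using that S additive_closure_add additive_closure_uminus by blast
    then have "real (card ?H) powr (p - 1) \<le> K"
      by (intro card_finite_subgroup_le fin) (auto intro: additive_closure.zero)
    moreover have "N \<le> card ?H"
      using S S0 fin additive_closure_base by (metis card_mono subset_iff)
    then have "real N powr (p - 1) \<le> real (card ?H) powr (p - 1)"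
      using p_gt1 by (intro powr_mono2) auto
    moreover have "K < real N powr (p - 1)"
    proof -
      have "K = (K powr (1 / (p - 1))) powr (p - 1)"
        using K_ge1 p_gt1 by (simp add: powr_powr)
      also have "\<dots> < real N powr (p - 1)"
        using N p_gt1 by (intro powr_less_mono2) auto
      finally show ?thesis .
    qed
    ultimately show False by simp
  qed
  define f :: "'a \<Rightarrow>\<^sub>0 real" where "f = (\<Sum>y\<in>S. Poly_Mapping.single y 1)"
  have look: "lookup f x = (if x \<in> S then 1 else 0)" for x
    using S by (simp add: f_def lookup_sum lookup_single when_def)
  have keys: "keys f = S" by (auto simp: in_keys_iff look split: if_splits)
  have f: "pm_nonneg f" by (auto simp: pm_nonneg_def look)
  have "S \<noteq> {}" using S S0 by (auto simp: N_def)
  then have "0 < pmass p f" using S by (simp add: pmass_def keys look card_gt_0_iff)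
  then obtain c where c: "0 < c" "\<And>n. pmass p ((Poly_Mapping.single 0 c * f) ^ n) \<le> 1"
    "\<And>n. 1 \<le> K * pmass p ((Poly_Mapping.single 0 c * f) ^ n)"
    using normalized_powers[OF f] by metis
  define h where "h = Poly_Mapping.single 0 c * f"
  have h: "pm_nonneg h" "\<And>n. pmass p (h ^ n) \<le> 1" "\<And>n. 1 \<le> K * pmass p (h ^ n)"
    using c f by (auto simp: h_def pm_nonneg_def lookup_single_times)
  have hn: "0 \<le> lookup (h ^ n) x" for n x
    using pm_nonneg_power[OF h(1)] by (simp add: pm_nonneg_def)
  have h_times: "lookup (h * g) x = c * (\<Sum>s\<in>S. lookup g (- s + x))" for g x
    by (simp add: h_def mult.assoc lookup_single_times) (simp add: lookup_times_eq_sum keys look)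
  obtain E \<delta> where E: "finite E" "\<delta> > 0" "\<And>n. \<exists>x\<in>E. lookup (h ^ n) x \<ge> \<delta>"
    using powers_do_not_escape[OF h] by blast
  \<comment> \<open>All powers live on the countable set \<open>Z\<close>, so a diagonal argument
    gives a subsequence of the means that converges at every point of \<open>Z\<close>.\<close>
  define Z where "Z = (\<Union>n. keys (h ^ n))"
  have "countable Z"
    unfolding Z_def by (intro countable_UN) (auto intro: countable_finite)
  have "x \<in> ?H" if "lookup (h ^ n) x \<noteq> 0" for n x
    using that
  proof (induction n arbitrary: x)
    case 0
    then show ?case by (auto simp: lookup_one when_def additive_closure.zero split: if_splits)
  next
    case (Suc n)
    then have "(\<Sum>s\<in>S. lookup (h ^ n) (- s + x)) \<noteq> 0" by (auto simp: h_times)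
    then obtain s where s: "s \<in> S" "lookup (h ^ n) (- s + x) \<noteq> 0"
      by (meson sum.neutral)
    then have "s + (- s + x) \<in> ?H" by (intro additive_closure.step Suc.IH)
    then show ?case by (simp add: add.assoc[symmetric])
  qed
  then have Z_H: "Z \<subseteq> ?H" by (auto simp: Z_def in_keys_iff)
  have off_Z: "lookup (h ^ n) x = 0" if "x \<notin> Z" for n x
    using that by (auto simp: Z_def in_keys_iff)
  \<comment> \<open>The Cesaro means, over \<open>Suc L\<close> powers so that the divisor is never
    0.\<close>
  define u where "u L x = (\<Sum>n<Suc L. lookup (h ^ n) x) / Suc L" for L x
  have u_nonneg: "0 \<le> u L x" for L x
    unfolding u_def by (intro divide_nonneg_nonneg sum_nonneg hn) auto
  have hn_le1: "lookup (h ^ n) x \<le> 1" for n x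
  proof (rule ccontr)
    assume "\<not> lookup (h ^ n) x \<le> 1"
    then have "1 < lookup (h ^ n) x powr p" using p_gt1 by (simp add: gr_one_powr)
    also have "\<dots> \<le> pmass p (h ^ n)" using sum_le_pmass[of "{x}" "h ^ n" p] by simp
    finally show False using h(2)[of n] by simp
  qed
  have u_le1: "u L x \<le> 1" for L x
  proof -
    have "(\<Sum>n<Suc L. lookup (h ^ n) x) \<le> (\<Sum>n<Suc L. 1)" by (intro sum_mono hn_le1)
    then show ?thesis by (simp add: u_def)
  qed
  have u_sum: "(\<Sum>x\<in>F. u L x powr p) \<le> 1" if "finite F" for F L
  proof -
    have "u L x powr p \<le> (\<Sum>n<Suc L. lookup (h ^ n) x powr p) / Suc L" for x
      using powr_mean_le[of "{..<Suc L}" "\<lambda>n. lookup (h ^ n) x" p] hn p_gt1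
      unfolding u_def by (simp add: lessThan_empty_iff del: sum.lessThan_Suc)
    then have "(\<Sum>x\<in>F. u L x powr p) \<le> (\<Sum>x\<in>F. (\<Sum>n<Suc L. lookup (h ^ n) x powr p) / Suc L)"
      by (rule sum_mono)
    also have "\<dots> = (\<Sum>n<Suc L. \<Sum>x\<in>F. lookup (h ^ n) x powr p) / Suc L"
      unfolding sum_divide_distrib[symmetric] by (subst sum.swap) (rule refl)
    also have "\<dots> \<le> (\<Sum>n<Suc L. 1) / Suc L"
      using sum_le_pmass[OF that] h(2) by (intro divide_right_mono sum_mono) (auto intro: order_trans)
    finally show ?thesis by simp
  qed
  have "norm (u L x) \<le> 1" for L x
    using u_nonneg u_le1 by simp
  then obtain k where k: "strict_mono (k :: nat \<Rightarrow> nat)"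
    and k_lim: "\<And>x. x \<in> Z \<Longrightarrow> \<exists>l. (\<lambda>n. u (k n) x) \<longlonglongrightarrow> l"
    by (rule function_convergent_subsequence[OF \<open>countable Z\<close>, of u 1]) blast
  have u_off: "u L x = 0" if "x \<notin> Z" for L x
    using off_Z[OF that] by (simp add: u_def)
  have "convergent (\<lambda>n. u (k n) x)" for x
  proof (cases "x \<in> Z")
    case True
    then show ?thesis using k_lim by (simp add: convergent_def)
  next
    case False
    then show ?thesis by (simp add: u_off convergent_const)
  qed
  then have q: "(\<lambda>n. u (k n) x) \<longlonglongrightarrow> lim (\<lambda>n. u (k n) x)" for x
    by (simp add: convergent_LIMSEQ_iff)
  define q where "q x = lim (\<lambda>n. u (k n) x)" for x
  note q = q[folded q_def]
  have q_nonneg: "0 \<le> q x" for x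
    by (rule LIMSEQ_le_const[OF q]) (use u_nonneg in auto)
  have q_sum: "(\<Sum>x\<in>F. q x powr p) \<le> 1" if "finite F" for F
  proof (rule LIMSEQ_le_const2)
    show "(\<lambda>n. \<Sum>x\<in>F. u (k n) x powr p) \<longlonglongrightarrow> (\<Sum>x\<in>F. q x powr p)"
      using p_gt1 u_nonneg by (intro tendsto_sum tendsto_powr' q tendsto_const) auto
  qed (use u_sum that in auto)
  \<comment> \<open>Multiplying the mean by \<open>h\<close> shifts the summation index; only the
    first and the last power differ, and their contribution is of order
    \<open>1 / Suc L\<close>.\<close>
  have u_step: "c * (\<Sum>s\<in>S. u L (- s + x)) = u L x + (lookup (h ^ Suc L) x - lookup (h ^ 0) x) / Suc L"
    for L x
  proof -
    have "(\<Sum>n<Suc L. lookup (h ^ Suc n) x) = c * (\<Sum>n<Suc L. \<Sum>s\<in>S. lookup (h ^ n) (- s + x))"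
      unfolding power_Suc h_times by (rule sum_distrib_left[symmetric])
    also have "\<dots> = c * (\<Sum>s\<in>S. \<Sum>n<Suc L. lookup (h ^ n) (- s + x))"
      by (subst sum.swap) (rule refl)
    finally have "c * (\<Sum>s\<in>S. u L (- s + x)) = (\<Sum>n<Suc L. lookup (h ^ Suc n) x) / Suc L"
      unfolding u_def sum_divide_distrib[symmetric] by simp
    also have "(\<Sum>n<Suc L. lookup (h ^ Suc n) x)
        = (\<Sum>n<Suc L. lookup (h ^ n) x) + lookup (h ^ Suc L) x - lookup (h ^ 0) x"
      by (induction L) auto
    finally show ?thesis by (simp add: u_def add_divide_distrib diff_divide_distrib)
  qed
  have q_eigen: "q x = c * (\<Sum>s\<in>S. q (- s + x))" for x
  proof (rule LIMSEQ_unique)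
    show "(\<lambda>n. c * (\<Sum>s\<in>S. u (k n) (- s + x))) \<longlonglongrightarrow> c * (\<Sum>s\<in>S. q (- s + x))"
      by (intro tendsto_intros q)
    have "(\<lambda>L. (lookup (h ^ Suc L) x - lookup (h ^ 0) x) / Suc L) \<longlonglongrightarrow> 0"
    proof (rule Lim_null_comparison)
      show "\<forall>\<^sub>F L in sequentially.
          norm ((lookup (h ^ Suc L) x - lookup (h ^ 0) x) / Suc L) \<le> 1 / Suc L"
      proof (intro always_eventually allI)
        fix L
        have "\<bar>lookup (h ^ Suc L) x - lookup (h ^ 0) x\<bar> \<le> 1"
          using hn[of "Suc L" x] hn_le1[of "Suc L" x] hn[of 0 x] hn_le1[of 0 x] by linarith
        then show "norm ((lookup (h ^ Suc L) x - lookup (h ^ 0) x) / Suc L) \<le> 1 / Suc L"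
          unfolding real_norm_def abs_divide by (simp add: divide_right_mono)
      qed
      show "(\<lambda>L. 1 / real (Suc L)) \<longlonglongrightarrow> 0"
        using LIMSEQ_inverse_real_of_nat by (simp add: inverse_eq_divide)
    qed
    from LIMSEQ_subseq_LIMSEQ[OF this k]
    have "(\<lambda>n. u (k n) x + (lookup (h ^ Suc (k n)) x - lookup (h ^ 0) x) / Suc (k n)) \<longlonglongrightarrow> q x + 0"
      by (intro tendsto_add q) (simp add: o_def)
    then show "(\<lambda>n. c * (\<Sum>s\<in>S. u (k n) (- s + x))) \<longlonglongrightarrow> q x"
      by (simp add: u_step)
  qed
  \<comment> \<open>Every power has sum at least \<open>\<delta>\<close> over the finite set
    \<open>E\<close>; this passes to the means and to their limit, so \<open>q\<close> is not
    zero.\<close>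
  have "\<delta> \<le> (\<Sum>x\<in>E. q x)"
  proof (rule LIMSEQ_le_const)
    show "(\<lambda>n. \<Sum>x\<in>E. u (k n) x) \<longlonglongrightarrow> (\<Sum>x\<in>E. q x)"
      by (intro tendsto_sum q)
    have "\<delta> \<le> (\<Sum>x\<in>E. u L x)" for L
    proof -
      have "\<delta> \<le> (\<Sum>x\<in>E. lookup (h ^ n) x)" for n
      proof -
        obtain x where "x \<in> E" "\<delta> \<le> lookup (h ^ n) x" using E by blast
        then show ?thesis
          using E hn member_le_sum[of x E "lookup (h ^ n)"] by fastforce
      qed
      then have "(\<Sum>n<Suc L. \<delta>) \<le> (\<Sum>n<Suc L. \<Sum>x\<in>E. lookup (h ^ n) x)" by (intro sum_mono)
      also have "\<dots> = (\<Sum>x\<in>E. \<Sum>n<Suc L. lookup (h ^ n) x)" by (rule sum.swap)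
      finally show ?thesis
        by (simp add: u_def sum_divide_distrib[symmetric] field_simps del: sum.lessThan_Suc)
    qed
    then show "\<exists>N. \<forall>n\<ge>N. \<delta> \<le> (\<Sum>x\<in>E. u (k n) x)" by blast
  qed
  then obtain x0 where x0: "0 < q x0"
    using E(2) sum_nonpos[of E q] by (meson not_le order.trans)
  have "x0 \<in> Z"
  proof (rule ccontr)
    assume "x0 \<notin> Z"
    then have "(\<lambda>n. u (k n) x0) \<longlonglongrightarrow> 0" by (simp add: u_off)
    then show False using LIMSEQ_unique[OF q[of x0]] x0 by simp
  qed
  with Z_H x0 show False
    using positive_eigenfunction_not_power_summable[OF S(1,2) inf_H _ assms q_nonneg q_sum c(1) q_eigen]
      p_gt1 by auto
qed

end

section \<open>Haar measures with an atom\<close>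

lemma radon_measureD:
  assumes "radon_measure M"
  shows "sets M = sets borel"
    and "\<And>K. compact K \<Longrightarrow> emeasure M K < \<infinity>"
    and "\<And>A. A \<in> sets borel \<Longrightarrow> emeasure M A = (INF U\<in>{U. open U \<and> A \<subseteq> U}. emeasure M U)"
    and "\<And>U. open U \<Longrightarrow> emeasure M U = (SUP K\<in>{K. compact K \<and> K \<subseteq> U}. emeasure M K)"
proof -
  note * = assms[unfolded radon_measure_def]
  note ** = conjunct2[OF conjunct2[OF *]]
  show "sets M = sets borel"
    by (rule conjunct1[OF *])
  show "emeasure M K < \<infinity>" if "compact K" for K
    by (rule conjunct1[OF conjunct2[OF *], rule_format, OF that])
  show "emeasure M A = (INF U\<in>{U. open U \<and> A \<subseteq> U}. emeasure M U)" if "A \<in> sets borel" for A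
    by (rule conjunct1[OF **, rule_format, OF that])
  show "emeasure M U = (SUP K\<in>{K. compact K \<and> K \<subseteq> U}. emeasure M K)" if "open U" for U
    by (rule conjunct2[OF **, rule_format, OF that])
qed

lemma left_haar_measureD:
  assumes "left_haar_measure M"
  shows "radon_measure M" and "emeasure M UNIV \<noteq> 0"
    and "\<And>x A. A \<in> sets borel \<Longrightarrow> emeasure M ((\<lambda>y. x + y) ` A) = emeasure M A"
  using assms unfolding left_haar_measure_def by blast+

lemma emeasure_translate_singleton:
  fixes \<mu> :: "'a::{topological_group_add, t2_space} measure"
  assumes "left_haar_measure \<mu>"
  shows "emeasure \<mu> {x} = emeasure \<mu> {0}"
proof -
  have "emeasure \<mu> ((\<lambda>y. x + y) ` {0}) = emeasure \<mu> {0}"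
    by (intro left_haar_measureD(3)[OF assms]) simp
  then show ?thesis by simp
qed

text \<open>By translation invariance all points have the same mass \<open>m\<close>. Outer
  regularity gives a neighbourhood of \<open>0\<close> of finite measure, which is then a finite
  set; in a Hausdorff space this makes points open, so every set is Borel and \<open>\<mu>\<close>
  counts points with weight \<open>m\<close>.\<close>

lemma haar_measure_with_atom:
  fixes \<mu> :: "'a::{topological_group_add, t2_space} measure"
  assumes haar: "left_haar_measure \<mu>" and atom: "emeasure \<mu> {0} \<noteq> 0"
  obtains m where "0 < m" "\<mu> = density (count_space UNIV) (\<lambda>_. ennreal m)"
proof -
  note radon = left_haar_measureD(1)[OF haar]
  note sets = radon_measureD(1)[OF radon]
  have fin: "emeasure \<mu> {0} < \<infinity>"
    by (rule radon_measureD(2)[OF radon]) simp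
  define m where "m = enn2real (emeasure \<mu> {0})"
  have m: "0 < m" "emeasure \<mu> {x} = ennreal m" for x
    using fin atom emeasure_translate_singleton[OF haar, of x]
    by (auto simp: m_def enn2real_positive_iff less_top zero_less_iff_neq_zero)
  have sing: "{x} \<in> sets \<mu>" for x by (simp add: sets)
  have fin_eq: "emeasure \<mu> A = ennreal m * of_nat (card A)" if "finite A" for A
    using that sing by (subst emeasure_eq_sum_singleton) (auto simp: m mult.commute)
  have inf_eq: "emeasure \<mu> A = \<infinity>" if A: "infinite A" "A \<in> sets \<mu>" for A
  proof (rule ccontr)
    assume "emeasure \<mu> A \<noteq> \<infinity>"
    then obtain r where r: "emeasure \<mu> A = ennreal r" "0 \<le> r"
      by (metis ennreal_cases infinity_ennreal_def)
    define n where "n = nat \<lceil>r / m\<rceil> + 1"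
    obtain B where B: "finite B" "card B = n" "B \<subseteq> A"
      using infinite_arbitrarily_large[OF A(1)] by blast
    have "real n > r / m" unfolding n_def by linarith
    then have "r < m * real n" using m by (simp add: field_simps)
    moreover have "ennreal (m * real n) \<le> ennreal r"
      using emeasure_mono[OF B(3) A(2)] fin_eq[OF B(1)] B r m
      by (simp add: ennreal_mult ennreal_of_nat_eq_real_of_nat)
    ultimately show False using r by (simp add: ennreal_le_iff)
  qed
  have "emeasure \<mu> {0} = (INF U\<in>{U. open U \<and> {0} \<subseteq> U}. emeasure \<mu> U)"
    by (rule radon_measureD(3)[OF radon]) simp
  then obtain U where U: "open U" "0 \<in> U" "emeasure \<mu> U < \<infinity>"
    using fin by (auto simp: INF_less_iff)
  have "finite U"
  proof (rule ccontr)
    assume "infinite U"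
    then have "emeasure \<mu> U = \<infinity>" using U(1) by (intro inf_eq) (auto simp: sets)
    with U(3) show False by simp
  qed
  have op: "open {x}" for x :: 'a
  proof -
    have "open (U - (U - {0}))"
      using U \<open>finite U\<close> by (intro open_Diff finite_imp_closed) auto
    moreover have "U - (U - {0}) = {0}" using U(2) by auto
    ultimately have "open ({0} :: 'a set)" by simp
    moreover have "continuous_on UNIV (\<lambda>y. - x + y)"
      by (intro continuous_intros)
    ultimately have "open ((\<lambda>y. - x + y) -` {0})"
      by (rule open_vimage)
    moreover have "- x + y = 0 \<longleftrightarrow> y = x" for y
      using neg_eq_iff_add_eq_0[of "- x" y] by auto
    then have "(\<lambda>y. - x + y) -` {0} = {x}" by blast
    ultimately show ?thesis by simp
  qed
  have op': "open A" for A :: "'a set"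
    using open_UN[of A "\<lambda>x. {x}"] op by simp
  have "\<mu> = density (count_space UNIV) (\<lambda>_. ennreal m)"
  proof (rule measure_eqI)
    show "sets \<mu> = sets (density (count_space UNIV) (\<lambda>_. ennreal m))"
      using op' by (auto simp: sets)
    fix A assume A: "A \<in> sets \<mu>"
    have "emeasure (density (count_space UNIV) (\<lambda>_. ennreal m)) A
        = ennreal m * emeasure (count_space UNIV) A"
      by (subst emeasure_density) (auto simp: nn_integral_cmult)
    then show "emeasure \<mu> A = emeasure (density (count_space UNIV) (\<lambda>_. ennreal m)) A"
      using fin_eq[of A] inf_eq[OF _ A] m
      by (cases "finite A") (auto simp: ennreal_mult_top)
  qed
  with m(1) show thesis by (rule that)
qed

lemma integrable_count_space_finite_support:
  fixes h :: "'a \<Rightarrow> 'b::{banach, second_countable_topology}"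
  assumes "finite Y" "\<And>y. y \<notin> Y \<Longrightarrow> h y = 0"
  shows "integrable (count_space UNIV) h"
proof -
  have "h = (\<lambda>x. \<Sum>y\<in>Y. indicator {y} x *\<^sub>R h y)"
  proof
    fix x
    have "(\<Sum>y\<in>Y. indicator {y} x *\<^sub>R h y) = (\<Sum>y\<in>Y. if y = x then h y else 0)"
      by (intro sum.cong) (auto simp: indicator_def)
    then show "h x = (\<Sum>y\<in>Y. indicator {y} x *\<^sub>R h y)"
      using assms by auto
  qed
  moreover have "integrable (count_space UNIV) (\<lambda>x. \<Sum>y\<in>Y. indicator {y} x *\<^sub>R h y)"
    by (intro Bochner_Integration.integrable_sum integrable_scaleR_left integrable_real_indicator) auto
  ultimately show ?thesis by simp
qed

text \<open>Every summand is at most the largest one, whose p-th power is a term of the sum on the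
  right. The crude constant suffices because it depends only on the size of the support.\<close>

lemma norm_sum_powr_le:
  fixes a :: "'i \<Rightarrow> 'b::real_normed_vector"
  assumes "finite Z" "0 \<le> p"
  shows "norm (\<Sum>z\<in>Z. a z) powr p \<le> real (card Z) powr p * (\<Sum>z\<in>Z. norm (a z) powr p)"
proof (cases "Z = {}")
  case False
  define M where "M = Max ((\<lambda>z. norm (a z)) ` Z)"
  have "M \<in> (\<lambda>z. norm (a z)) ` Z"
    unfolding M_def using assms False by (intro Max_in) auto
  then obtain z where z: "z \<in> Z" "M = norm (a z)" by blast
  have "norm (\<Sum>z\<in>Z. a z) \<le> (\<Sum>z\<in>Z. M)"
    by (rule sum_norm_le) (use assms in \<open>auto simp: M_def\<close>)
  then have "norm (\<Sum>z\<in>Z. a z) powr p \<le> (real (card Z) * M) powr p"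
    using assms by (intro powr_mono2) auto
  also have "\<dots> = real (card Z) powr p * M powr p"
    using z by (simp add: powr_mult)
  also have "M powr p \<le> (\<Sum>z\<in>Z. norm (a z) powr p)"
    unfolding z(2) using assms z by (intro member_le_sum) auto
  finally show ?thesis by (simp add: mult_left_mono)
qed simp

lemma Lp_norm_convolution_le_LpT_norm:
  assumes "f \<in> LpT_space M p" "g \<in> Lp_space M p" "Lp_norm M p g \<le> 1"
  shows "Lp_norm M p (convolution M g f) \<le> LpT_norm M p f"
  unfolding LpT_norm_def
proof (rule cSup_upper)
  show "bdd_above {Lp_norm M p (convolution M g f) | g. g \<in> Lp_space M p \<and> Lp_norm M p g \<le> 1}"
    using assms(1) by (simp only: LpT_space_def mem_Collect_eq)
qed (use assms in blast)

lemma zero_in_Lp_space: "(\<lambda>_. 0) \<in> Lp_space M p"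
  by (simp add: Lp_space_def)

lemma Lp_norm_zero: "Lp_norm M p (\<lambda>_. 0) = 0"
  by (simp add: Lp_norm_def)

lemma LpT_spaceI:
  assumes "f \<in> Lp_space M p" "0 \<le> B"
    and "\<And>g. g \<in> Lp_space M p \<Longrightarrow> convolution_exists M g f \<and> convolution M g f \<in> Lp_space M p \<and>
      Lp_norm M p (convolution M g f) \<le> B * Lp_norm M p g"
  shows "f \<in> LpT_space M p" "LpT_norm M p f \<le> B"
proof -
  have le: "Lp_norm M p (convolution M g f) \<le> B"
    if "g \<in> Lp_space M p" "Lp_norm M p g \<le> 1" for g
    using assms(3)[OF that(1)] mult_left_mono[OF that(2) assms(2)] by simp
  show "f \<in> LpT_space M p"
    unfolding LpT_space_def using assms le by (auto intro!: bdd_aboveI[of _ B])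
  show "LpT_norm M p f \<le> B"
    unfolding LpT_norm_def
    \<comment> \<open>The zero function shows that the supremum is taken over a nonempty
      set.\<close>
    by (rule cSup_least) (use le zero_in_Lp_space[of M p] Lp_norm_zero[of M p] in \<open>auto intro!: exI[of _ "\<lambda>_. 0"]\<close>)
qed

section \<open>Convolution for a multiple of the counting measure\<close>

context
  fixes \<mu> :: "'a::{topological_group_add, t2_space} measure" and m p :: real
  assumes m: "0 < m" and \<mu>: "\<mu> = density (count_space UNIV) (\<lambda>_. ennreal m)"
    and p: "1 < p"
begin

lemma integrable_density_const:
  fixes h :: "'a \<Rightarrow> 'b::{banach, second_countable_topology}"
  shows "integrable \<mu> h \<longleftrightarrow> integrable (count_space UNIV) h"
proof -
  have "integrable \<mu> h \<longleftrightarrow> integrable (count_space UNIV) (\<lambda>x. m *\<^sub>R h x)"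
    unfolding \<mu> using m by (subst integrable_density) auto
  also have "\<dots> \<longleftrightarrow> integrable (count_space UNIV) h"
    using m Bochner_Integration.integrable_scaleR_right[of m "count_space UNIV" h]
      Bochner_Integration.integrable_scaleR_right[of "inverse m" "count_space UNIV" "\<lambda>x. m *\<^sub>R h x"]
    by auto
  finally show ?thesis .
qed

lemma integral_density_const:
  fixes h :: "'a \<Rightarrow> 'b::{banach, second_countable_topology}"
  shows "(\<integral>x. h x \<partial>\<mu>) = m *\<^sub>R (\<integral>x. h x \<partial>count_space UNIV)"
  unfolding \<mu> using m by (subst integral_density) auto

lemma measurable_density_const: "h \<in> borel_measurable \<mu>"
  unfolding \<mu> by simp

lemma integral_finite_support:
  fixes h :: "'a \<Rightarrow> 'b::{banach, second_countable_topology}"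
  assumes "finite Y" "\<And>y. y \<notin> Y \<Longrightarrow> h y = 0"
  shows "integrable \<mu> h" "(\<integral>x. h x \<partial>\<mu>) = m *\<^sub>R (\<Sum>y\<in>Y. h y)"
proof -
  show "integrable \<mu> h"
    unfolding integrable_density_const by (rule integrable_count_space_finite_support) (use assms in auto)
  have "(\<integral>x. h x \<partial>count_space UNIV) = (\<Sum>y | h y \<noteq> 0. h y)"
    by (subst lebesgue_integral_count_space_finite_support) (use assms in \<open>auto intro: finite_subset[of _ Y]\<close>)
  also have "\<dots> = (\<Sum>y\<in>Y. h y)"
    by (rule sum.mono_neutral_left) (use assms in auto)
  finally show "(\<integral>x. h x \<partial>\<mu>) = m *\<^sub>R (\<Sum>y\<in>Y. h y)"
    by (simp add: integral_density_const)
qed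

lemma finite_support_in_Lp_space:
  fixes f :: "'a \<Rightarrow> complex"
  assumes "finite Z" "\<And>x. x \<notin> Z \<Longrightarrow> f x = 0"
  shows "f \<in> Lp_space \<mu> p"
    "Lp_norm \<mu> p f = (m * (\<Sum>x\<in>Z. norm (f x) powr p)) powr (1 / p)"
proof -
  have 0: "norm (f x) powr p = 0" if "x \<notin> Z" for x using assms that by simp
  show "f \<in> Lp_space \<mu> p"
    using integral_finite_support(1)[OF assms(1) 0] by (simp add: Lp_space_def measurable_density_const)
  show "Lp_norm \<mu> p f = (m * (\<Sum>x\<in>Z. norm (f x) powr p)) powr (1 / p)"
    using integral_finite_support(2)[OF assms(1) 0] by (simp add: Lp_norm_def)
qed

lemma convolution_finite_support:
  fixes f g :: "'a \<Rightarrow> complex"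
  assumes "finite Z" "\<And>x. x \<notin> Z \<Longrightarrow> f x = 0"
  shows "convolution_exists \<mu> g f"
    "convolution \<mu> g f x = of_real m * (\<Sum>z\<in>Z. g (x - z) * f z)"
proof -
  have 0: "g y * f (- y + x) = 0" if "y \<notin> (\<lambda>z. x - z) ` Z" for x y
  proof -
    have "- y + x \<notin> Z"
    proof
      assume "- y + x \<in> Z"
      moreover have "y = x - (- y + x)" by (simp add: diff_conv_add_uminus minus_add add.assoc[symmetric])
      ultimately show False using that by blast
    qed
    then show ?thesis using assms by simp
  qed
  show "convolution_exists \<mu> g f"
    unfolding convolution_exists_def
    by (intro always_eventually allI integral_finite_support(1)[OF _ 0]) (use assms(1) in auto)
  have "convolution \<mu> g f x = m *\<^sub>R (\<Sum>y\<in>(\<lambda>z. x - z) ` Z. g y * f (- y + x))"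
    unfolding convolution_def by (rule integral_finite_support(2)[OF _ 0]) (use assms in auto)
  also have "(\<Sum>y\<in>(\<lambda>z. x - z) ` Z. g y * f (- y + x)) = (\<Sum>z\<in>Z. g (x - z) * f z)"
  proof -
    have "inj_on (\<lambda>z. x - z) Z"
      by (rule inj_onI) (metis add_left_cancel diff_conv_add_uminus neg_equal_iff_equal)
    moreover have "- (x - z) + x = z" for z
      by (simp add: minus_diff_eq)
    ultimately show ?thesis by (simp add: sum.reindex)
  qed
  finally show "convolution \<mu> g f x = of_real m * (\<Sum>z\<in>Z. g (x - z) * f z)"
    by (simp add: scaleR_conv_of_real)
qed

text \<open>The convolution is a combination of finitely many right translates of \<open>g\<close>,
  whose p-th powers have the same integral for the counting measure.\<close>

lemma Lp_norm_convolution_finite_support: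
  fixes f g :: "'a \<Rightarrow> complex"
  assumes Z: "finite Z" "\<And>x. x \<notin> Z \<Longrightarrow> f x = 0" and g: "g \<in> Lp_space \<mu> p"
  defines "D \<equiv> (m powr (p - 1) * real (card Z) powr p) powr (1 / p)"
  shows "convolution \<mu> g f \<in> Lp_space \<mu> p"
    "Lp_norm \<mu> p (convolution \<mu> g f) \<le> D * Lp_norm \<mu> p f * Lp_norm \<mu> p g"
proof -
  let ?C = "count_space UNIV :: 'a measure"
  define G where "G = (\<integral>x. norm (g x) powr p \<partial>?C)"
  define b where "b x = m powr p * (real (card Z) powr p * (\<Sum>z\<in>Z. norm (f z) powr p * norm (g (x - z)) powr p))" for x
  have bij: "bij_betw (\<lambda>x. x - z) UNIV UNIV" for z :: 'a
    by (rule bij_betwI[where g="\<lambda>x. x + z"]) auto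
  have g_int: "integrable ?C (\<lambda>x. norm (g x) powr p)"
    using g by (simp add: Lp_space_def integrable_density_const)
  have gz: "integrable ?C (\<lambda>x. norm (g (x - z)) powr p)" "(\<integral>x. norm (g (x - z)) powr p \<partial>?C) = G" for z
    using integrable_bij_count_space[OF bij[of z], of "\<lambda>x. norm (g x) powr p"]
      integral_bij_count_space[OF bij[of z], of "\<lambda>x. norm (g x) powr p"] g_int
    by (auto simp: G_def)
  have b_int: "integrable ?C b"
    unfolding b_def by (intro integrable_mult_right Bochner_Integration.integrable_sum gz)
  have b_eq: "(\<integral>x. b x \<partial>?C) = m powr p * (real (card Z) powr p * ((\<Sum>z\<in>Z. norm (f z) powr p) * G))"
    unfolding b_def using gz by (simp add: Bochner_Integration.integral_sum sum_distrib_right)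
  have le: "norm (convolution \<mu> g f x) powr p \<le> b x" for x
  proof -
    have "norm (convolution \<mu> g f x) powr p = m powr p * norm (\<Sum>z\<in>Z. g (x - z) * f z) powr p"
      using m by (simp add: convolution_finite_support(2)[OF Z] norm_mult powr_mult)
    also have "\<dots> \<le> m powr p * (real (card Z) powr p * (\<Sum>z\<in>Z. norm (g (x - z) * f z) powr p))"
      using p by (intro mult_left_mono norm_sum_powr_le Z) auto
    finally show ?thesis by (simp add: b_def norm_mult powr_mult mult.commute)
  qed
  have c_int: "integrable ?C (\<lambda>x. norm (convolution \<mu> g f x) powr p)"
    by (rule Bochner_Integration.integrable_bound[OF b_int])
       (auto intro!: always_eventually order_trans[OF le abs_ge_self])
  then show "convolution \<mu> g f \<in> Lp_space \<mu> p"
    by (simp add: Lp_space_def measurable_density_const integrable_density_const)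
  have "(\<integral>x. norm (convolution \<mu> g f x) powr p \<partial>\<mu>) \<le> m * (\<integral>x. b x \<partial>?C)"
    using integral_mono[OF c_int b_int] le m by (simp add: integral_density_const)
  \<comment> \<open>The factor \<open>m * m powr p\<close> is split so that the integrals of
    \<open>f\<close> and of \<open>g\<close> each receive one factor \<open>m\<close>.\<close>
  also have "\<dots> = (m powr (p - 1) * real (card Z) powr p) * (m * (\<Sum>z\<in>Z. norm (f z) powr p)) * (m * G)"
    using m p by (simp add: b_eq powr_diff)
  finally have "Lp_norm \<mu> p (convolution \<mu> g f)
    \<le> ((m powr (p - 1) * real (card Z) powr p) * (m * (\<Sum>z\<in>Z. norm (f z) powr p)) * (m * G)) powr (1 / p)"
    unfolding Lp_norm_def using p by (intro powr_mono2) auto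
  also have "\<dots> = D * Lp_norm \<mu> p f * Lp_norm \<mu> p g"
    using m by (simp add: D_def finite_support_in_Lp_space(2)[OF Z] Lp_norm_def[of _ _ g]
        integral_density_const G_def powr_mult sum_nonneg)
  finally show "Lp_norm \<mu> p (convolution \<mu> g f) \<le> D * Lp_norm \<mu> p f * Lp_norm \<mu> p g" .
qed

lemma finite_support_in_LpT_space:
  fixes f :: "'a \<Rightarrow> complex"
  assumes Z: "finite Z" "\<And>x. x \<notin> Z \<Longrightarrow> f x = 0"
  shows "f \<in> LpT_space \<mu> p"
    "LpT_norm \<mu> p f \<le> (m powr (p - 1) * real (card Z) powr p) powr (1 / p) * Lp_norm \<mu> p f"
proof -
  let ?B = "(m powr (p - 1) * real (card Z) powr p) powr (1 / p) * Lp_norm \<mu> p f"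
  have *: "f \<in> Lp_space \<mu> p" "0 \<le> ?B"
    "convolution_exists \<mu> g f \<and> convolution \<mu> g f \<in> Lp_space \<mu> p \<and>
      Lp_norm \<mu> p (convolution \<mu> g f) \<le> ?B * Lp_norm \<mu> p g" if "g \<in> Lp_space \<mu> p" for g
    using finite_support_in_Lp_space(1)[OF Z] convolution_finite_support(1)[OF Z]
      Lp_norm_convolution_finite_support[OF Z that] by (auto simp: Lp_norm_def)
  note 0 = zero_in_Lp_space[of \<mu> p]
  show "f \<in> LpT_space \<mu> p" "LpT_norm \<mu> p f \<le> ?B"
    by (rule LpT_spaceI[OF *(1)[OF 0] *(2)[OF 0]]; use *(3) in blast)+
qed

text \<open>With the whole group as support, \<open>finite_support_in_LpT_space\<close> bounds
  \<open>LpT_norm\<close> from above; testing with a point mass at \<open>0\<close> gives a multiple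
  of \<open>f\<close> and hence the lower bound.\<close>

lemma equivalent_norms_of_finite:
  assumes "finite (UNIV :: 'a set)"
  shows "equivalent_norms_on (LpT_space \<mu> p) (Lp_norm \<mu> p) (LpT_norm \<mu> p)"
proof -
  define C where "C = (m powr (p - 1) * real (card (UNIV :: 'a set)) powr p) powr (1 / p)"
  \<comment> \<open>The value at \<open>0\<close> gives \<open>g\<close> norm 1, as points have mass
    \<open>m\<close>.\<close>
  define g :: "'a \<Rightarrow> complex" where "g x = (if x = 0 then of_real (m powr (- 1 / p)) else 0)" for x
  have "norm (g 0) powr p = inverse m"
    using m p by (simp add: g_def powr_powr norm_inverse powr_minus inverse_powr)
  then have g: "g \<in> Lp_space \<mu> p" "Lp_norm \<mu> p g \<le> 1"
    using finite_support_in_Lp_space[of "{0}" g] m by (auto simp: g_def)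
  have C: "0 < C" using m assms finite_UNIV_card_ge_0 by (simp add: C_def)
  have conv: "convolution \<mu> g f x = of_real (m * m powr (- 1 / p)) * f x" for f x
  proof -
    have "(\<Sum>z\<in>UNIV. g (x - z) * f z) = (\<Sum>z\<in>UNIV. if z = x then of_real (m powr (- 1 / p)) * f z else 0)"
      by (intro sum.cong) (auto simp: g_def)
    also have "\<dots> = of_real (m powr (- 1 / p)) * f x"
      using assms by simp
    finally show ?thesis
      using convolution_finite_support(2)[of UNIV f g x] assms by simp
  qed
  define c where "c = m * m powr (- 1 / p)"
  have c: "0 < c" using m by (simp add: c_def)
  have "Lp_norm \<mu> p (convolution \<mu> g f) = c * Lp_norm \<mu> p f" for f
  proof -
    have "convolution \<mu> g f = (\<lambda>x. of_real c * f x)"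
      by (rule ext) (simp only: conv c_def)
    then have "Lp_norm \<mu> p (convolution \<mu> g f) = (c powr p * (\<integral>x. norm (f x) powr p \<partial>\<mu>)) powr (1 / p)"
      using c by (simp add: Lp_norm_def norm_mult powr_mult)
    also have "\<dots> = c * Lp_norm \<mu> p f"
      using c p by (simp add: Lp_norm_def powr_mult powr_powr)
    finally show ?thesis .
  qed
  then have "c * Lp_norm \<mu> p f \<le> LpT_norm \<mu> p f" if "f \<in> LpT_space \<mu> p" for f
    using Lp_norm_convolution_le_LpT_norm[OF that g] by simp
  moreover have "LpT_norm \<mu> p f \<le> C * Lp_norm \<mu> p f" for f
    unfolding C_def by (rule finite_support_in_LpT_space(2)) (use assms in auto)
  ultimately show ?thesis
    unfolding equivalent_norms_on_def using c C by blast
qed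

text \<open>The bound for finitely supported functions, tested against nonnegative functions, is the
  submultiplicativity required by \<open>lp_convolution_algebra\<close>.\<close>

lemma finite_of_LpT_norm_le:
  assumes "p \<le> 2" and C: "0 < C" "\<And>f. f \<in> LpT_space \<mu> p \<Longrightarrow> LpT_norm \<mu> p f \<le> C * Lp_norm \<mu> p f"
  shows "finite (UNIV :: 'a set)"
proof -
  \<comment> \<open>\<open>C powr p\<close> comes from taking p-th powers,
    \<open>m powr (1 - p)\<close> from replacing \<open>\<mu>\<close> by the counting measure; the
    maximum ensures \<open>1 \<le> K\<close>.\<close>
  define K where "K = max 1 (C powr p * m powr (1 - p))"
  have "lp_convolution_algebra TYPE('a) p K"
  proof
    show "1 < p" by (rule p)
    show "1 \<le> K" by (simp add: K_def)
    fix f g :: "'a \<Rightarrow>\<^sub>0 real" assume f: "pm_nonneg f" and g: "pm_nonneg g"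
    define emb where "emb h x = complex_of_real (lookup h x)" for h :: "'a \<Rightarrow>\<^sub>0 real" and x
    have norm_emb: "Lp_norm \<mu> p (emb h) = (m * pmass p h) powr (1 / p)" "emb h \<in> Lp_space \<mu> p"
      if "pm_nonneg h" for h
      using finite_support_in_Lp_space[of "keys h" "emb h"] that
      by (auto simp: emb_def in_keys_iff pmass_def pm_nonneg_def)
    show "pmass p (f * g) \<le> K * pmass p f * pmass p g"
    proof (cases "pmass p f = 0")
      case True
      have "f = 0"
      proof (rule poly_mapping_eqI)
        fix x
        have "lookup f x powr p \<le> 0" using sum_le_pmass[of "{x}" f p] True by simp
        then show "lookup f x = lookup 0 x" by simp
      qed
      then show ?thesis by (simp add: pmass_def)
    next
      case False
      then have fpos: "0 < pmass p f" using pmass_nonneg[of p f] by simp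
      \<comment> \<open>\<open>LpT_norm\<close> only tests functions of norm at most 1, so
        \<open>f\<close> is scaled to norm 1; hence the separate case
        \<open>pmass p f = 0\<close>.\<close>
      define t where "t = inverse ((m * pmass p f) powr (1 / p))"
      have t: "0 < t" using fpos m by (simp add: t_def)
      have tp: "t powr p = inverse (m * pmass p f)"
        using fpos m p by (simp add: t_def powr_powr inverse_powr)
      define f' where "f' = Poly_Mapping.single 0 t * f"
      have f': "pm_nonneg f'" using f t by (auto simp: f'_def pm_nonneg_def lookup_single_times)
      have "Lp_norm \<mu> p (emb f') \<le> 1"
      proof -
        have "m * pmass p f' = 1"
          using f t fpos m by (simp add: f'_def pmass_scale tp field_simps)
        then show ?thesis using norm_emb[OF f'] by simp
      qed
      then have "Lp_norm \<mu> p (convolution \<mu> (emb f') (emb g)) \<le> LpT_norm \<mu> p (emb g)"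
        by (intro Lp_norm_convolution_le_LpT_norm norm_emb f' finite_support_in_LpT_space(1)[of "keys g"])
           (auto simp: emb_def in_keys_iff)
      also have "\<dots> \<le> C * Lp_norm \<mu> p (emb g)"
        by (intro C finite_support_in_LpT_space(1)[of "keys g"]) (auto simp: emb_def in_keys_iff)
      also have "convolution \<mu> (emb f') (emb g) = emb (Poly_Mapping.single 0 m * (f' * g))"
      proof
        fix x
        have "lookup (f' * g) x = (\<Sum>y\<in>keys f'. lookup f' y * lookup g (- y + x))"
          by (rule lookup_times_eq_sum)
        moreover have "convolution \<mu> (emb f') (emb g) x
            = of_real m * (\<Sum>y\<in>keys f'. emb f' y * emb g (- y + x))"
          unfolding convolution_def
          by (subst integral_finite_support(2)[of "keys f'"])
             (auto simp: emb_def in_keys_iff scaleR_conv_of_real)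
        ultimately show "convolution \<mu> (emb f') (emb g) x = emb (Poly_Mapping.single 0 m * (f' * g)) x"
          by (simp add: emb_def lookup_single_times)
      qed
      also have "Lp_norm \<mu> p (emb (Poly_Mapping.single 0 m * (f' * g)))
          = (m * pmass p (Poly_Mapping.single 0 m * (f' * g))) powr (1 / p)"
        using pm_nonneg_mult[OF f' g] m
        by (intro norm_emb) (auto simp: pm_nonneg_def lookup_single_times)
      finally have "(m * pmass p (Poly_Mapping.single 0 m * (f' * g))) powr (1 / p)
          \<le> C * (m * pmass p g) powr (1 / p)"
        by (simp only: norm_emb(1)[OF g])
      then have "((m * pmass p (Poly_Mapping.single 0 m * (f' * g))) powr (1 / p)) powr p
          \<le> (C * (m * pmass p g) powr (1 / p)) powr p"
        using p by (intro powr_mono2) auto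
      then have "m * pmass p (Poly_Mapping.single 0 m * (f' * g)) \<le> C powr p * (m * pmass p g)"
        using m p C by (simp add: powr_powr powr_mult pmass_nonneg)
      moreover have "pmass p (Poly_Mapping.single 0 m * (f' * g)) = m powr p * pmass p (f' * g)"
        using m by (intro pmass_scale pm_nonneg_mult f' g) simp
      moreover have "f' * g = Poly_Mapping.single 0 t * (f * g)"
        by (simp only: f'_def mult.assoc)
      moreover have "pmass p (Poly_Mapping.single 0 t * (f * g)) = t powr p * pmass p (f * g)"
        using t by (intro pmass_scale pm_nonneg_mult f g) simp
      ultimately have "m * (m powr p * (inverse (m * pmass p f) * pmass p (f * g))) \<le> C powr p * (m * pmass p g)"
        by (simp add: tp)
      then have "pmass p (f * g) \<le> C powr p * m powr (1 - p) * pmass p f * pmass p g"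
        using m fpos by (simp add: field_simps powr_diff)
      also have "\<dots> \<le> K * pmass p f * pmass p g"
        by (intro mult_right_mono pmass_nonneg) (auto simp: K_def)
      finally show ?thesis .
    qed
  qed
  then show ?thesis
    using assms(1) by (rule lp_convolution_algebra.finite_group)
qed

end

section \<open>Haar measures without atoms\<close>

lemma open_translation_group:
  fixes U :: "'a::topological_group_add set"
  assumes "open U"
  shows "open ((\<lambda>y. x + y) ` U)"
proof -
  have "(\<lambda>y. x + y) ` U = (\<lambda>y. - x + y) -` U"
  proof (intro set_eqI iffI)
    fix y assume "y \<in> (\<lambda>y. - x + y) -` U"
    then have "x + (- x + y) \<in> (\<lambda>y. x + y) ` U" by (intro imageI) simp
    then show "y \<in> (\<lambda>y. x + y) ` U" by (simp add: add.assoc[symmetric])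
  qed (auto simp: add.assoc[symmetric])
  moreover have "continuous_on UNIV (\<lambda>y. - x + y)"
    by (intro continuous_intros)
  ultimately show ?thesis
    using open_vimage[OF assms] by simp
qed

text \<open>Otherwise finitely many null translates of \<open>U\<close> cover each compact set, and
  inner regularity makes the whole group null.\<close>

lemma haar_measure_open_pos:
  fixes \<mu> :: "'a::topological_group_add measure"
  assumes haar: "left_haar_measure \<mu>" and U: "open U" "0 \<in> U"
  shows "emeasure \<mu> U \<noteq> 0"
proof
  assume 0: "emeasure \<mu> U = 0"
  note radon = left_haar_measureD(1)[OF haar]
  note sets = radon_measureD(1)[OF radon]
  have null: "(\<lambda>y. x + y) ` U \<in> null_sets \<mu>" for x
    using left_haar_measureD(3)[OF haar, of U x] U 0 open_translation_group[OF U(1), of x]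
    by (auto simp: sets)
  have "emeasure \<mu> K \<le> 0" if cK: "compact K" for K
  proof -
    have cover: "K \<subseteq> (\<Union>x\<in>K. (\<lambda>y. x + y) ` U)"
    proof
      fix x assume "x \<in> K"
      moreover have "x + 0 \<in> (\<lambda>y. x + y) ` U" using U by (intro imageI)
      ultimately show "x \<in> (\<Union>x\<in>K. (\<lambda>y. x + y) ` U)" by auto
    qed
    obtain C where C: "C \<subseteq> K" "finite C" "K \<subseteq> (\<Union>x\<in>C. (\<lambda>y. x + y) ` U)"
      by (rule compactE_image[where f="\<lambda>x. (\<lambda>y. x + y) ` U", OF cK open_translation_group[OF U(1)] cover])
        blast
    have N: "(\<Union>x\<in>C. (\<lambda>y. x + y) ` U) \<in> null_sets \<mu>"
      using C(2) null by (intro null_sets_UN') (auto intro: countable_finite)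
    show ?thesis
      using emeasure_mono[OF C(3), of \<mu>] N by (auto simp: null_sets_def)
  qed
  then have "emeasure \<mu> UNIV \<le> 0"
    unfolding radon_measureD(4)[OF radon open_UNIV] by (intro SUP_least) auto
  then show False using left_haar_measureD(2)[OF haar] by simp
qed

text \<open>
  For spaces without a countable base the product of the Borel \<open>\<sigma>\<close>-algebras need not contain all
  open sets. Here each compact set where \<open>F \<ge> s + 1 / Suc n\<close> in the box is covered by finitely many
  open rectangles on which \<open>s < F\<close>.
\<close>

lemma continuous_superlevel_in_product_sigma:
  fixes F :: "'a::t2_space \<times> 'b::t2_space \<Rightarrow> real"
  assumes cont: "continuous_on UNIV F" and A: "compact A" and B: "compact B"
  shows "{z \<in> A \<times> B. s < F z} \<in> sets (borel \<Otimes>\<^sub>M borel)"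
proof -
  have op: "open {z. s < F z}"
    using cont by (intro open_Collect_less continuous_intros)
  have ex: "\<exists>R. R \<in> sets (borel \<Otimes>\<^sub>M borel) \<and> {z \<in> A \<times> B. s + 1 / Suc n \<le> F z} \<subseteq> R \<and> R \<subseteq> {z. s < F z}" for n
  proof -
    let ?C = "{z \<in> A \<times> B. s + 1 / Suc n \<le> F z}"
    have "closed {z. s + 1 / Suc n \<le> F z}"
      using cont by (intro closed_Collect_le continuous_intros)
    then have "compact ((A \<times> B) \<inter> {z. s + 1 / Suc n \<le> F z})"
      by (intro compact_Int_closed compact_Times A B)
    moreover have "(A \<times> B) \<inter> {z. s + 1 / Suc n \<le> F z} = ?C" by blast
    ultimately have comp: "compact ?C" by simp
    define \<R> where "\<R> = {P \<times> Q | P Q. open P \<and> open Q \<and> P \<times> Q \<subseteq> {z. s < F z}}"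
    have opR: "open T" if "T \<in> \<R>" for T
      using that by (auto simp: \<R>_def intro: open_Times)
    have cover: "?C \<subseteq> (\<Union>T\<in>\<R>. T)"
    proof
      fix z assume z: "z \<in> ?C"
      have "0 < 1 / real (Suc n)" by simp
      moreover have "s + 1 / real (Suc n) \<le> F z" using z by simp
      ultimately have "s < F z" by linarith
      then have "z \<in> {z. s < F z}" by simp
      with op obtain P Q where "open P" "open Q" "z \<in> P \<times> Q" "P \<times> Q \<subseteq> {z. s < F z}"
        by (rule open_prod_elim)
      then show "z \<in> (\<Union>T\<in>\<R>. T)" by (auto simp: \<R>_def)
    qed
    obtain C' where C': "C' \<subseteq> \<R>" "finite C'" "?C \<subseteq> (\<Union>T\<in>C'. T)"
      by (rule compactE_image[where f="\<lambda>T. T", OF comp opR cover]) blast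
    have "T \<in> sets (borel \<Otimes>\<^sub>M borel)" if "T \<in> C'" for T
      using that C'(1) by (auto simp: \<R>_def intro!: pair_measureI)
    then have "(\<Union>T\<in>C'. T) \<in> sets (borel \<Otimes>\<^sub>M borel)"
      using C'(2) by (intro sets.finite_UN) auto
    moreover have "(\<Union>T\<in>C'. T) \<subseteq> {z. s < F z}"
      using C'(1) by (auto simp: \<R>_def)
    ultimately show ?thesis using C'(3) by blast
  qed
  have "\<exists>R. \<forall>n. R n \<in> sets (borel \<Otimes>\<^sub>M borel) \<and>
      {z \<in> A \<times> B. s + 1 / Suc n \<le> F z} \<subseteq> R n \<and> R n \<subseteq> {z. s < F z}"
    by (intro choice allI ex)
  then obtain R where "\<forall>n. R n \<in> sets (borel \<Otimes>\<^sub>M borel) \<and>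
      {z \<in> A \<times> B. s + 1 / Suc n \<le> F z} \<subseteq> R n \<and> R n \<subseteq> {z. s < F z}"
    by (rule exE)
  then have R: "R n \<in> sets (borel \<Otimes>\<^sub>M borel)"
    "{z \<in> A \<times> B. s + 1 / Suc n \<le> F z} \<subseteq> R n" "R n \<subseteq> {z. s < F z}" for n
    by simp_all
  have "{z \<in> A \<times> B. s < F z} = (A \<times> B) \<inter> (\<Union>n. R n)"
  proof (intro set_eqI iffI)
    fix z assume z: "z \<in> {z \<in> A \<times> B. s < F z}"
    then obtain n where "1 / real (Suc n) < F z - s"
      using nat_approx_posE[of "F z - s"] by auto
    then have "z \<in> {z \<in> A \<times> B. s + 1 / Suc n \<le> F z}" using z by auto
    then show "z \<in> (A \<times> B) \<inter> (\<Union>n. R n)" using R(2)[of n] by blast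
  qed (use R(3) in blast)
  moreover have "A \<times> B \<in> sets (borel \<Otimes>\<^sub>M borel)"
    using A B by (intro pair_measureI borel_closed compact_imp_closed)
  ultimately show ?thesis
    using R(1) by simp
qed

text \<open>A locally compact Hausdorff space is completely regular, so a continuous
  \<open>\<kappa>\<close> separates \<open>0\<close> from the complement of
  \<open>W \<inter> V\<close>; the product over \<open>x\<close> and \<open>- x\<close> symmetrises
  it. The neighbourhood is given by a function \<open>k\<close> so that
  \<open>continuous_superlevel_in_product_sigma\<close> applies to it.\<close>

lemma symmetric_neighborhood:
  fixes W :: "'a::{topological_group_add, t2_space} set"
  assumes lc: "locally_compact_space (euclidean :: 'a topology)" and W: "open W" "0 \<in> W"
  obtains k :: "'a \<Rightarrow> real" and K where "continuous_on UNIV k" "\<And>x. k (- x) = k x"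
    "0 < k 0" "compact K" "{x. 0 < k x} \<subseteq> W \<inter> K"
proof -
  have "\<exists>V K. openin euclidean V \<and> compactin euclidean K \<and> (0 :: 'a) \<in> V \<and> V \<subseteq> K"
    by (rule lc[unfolded locally_compact_space_def, rule_format]) simp
  then obtain V K :: "'a set" where V: "open V" "0 \<in> V" "V \<subseteq> K" and K: "compact K"
    by auto
  have "completely_regular_space (euclidean :: 'a topology)"
    using lc by (intro locally_compact_regular_imp_completely_regular_space disjI1)
      (simp_all add: Hausdorff_space_def disjnt_def separation_t2)
  moreover have "closedin euclidean (- (W \<inter> V))" "0 \<in> topspace euclidean - (- (W \<inter> V))"
    using V W by (auto simp: closed_def[symmetric] intro: closed_Compl)
  ultimately have "\<exists>\<kappa>::'a \<Rightarrow> real. continuous_map euclidean (top_of_set {0..1}) \<kappa> \<and>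
      \<kappa> 0 = 0 \<and> \<kappa> ` (- (W \<inter> V)) \<subseteq> {1}"
    unfolding completely_regular_space_def by simp
  then obtain \<kappa> where \<kappa>: "continuous_map euclidean (top_of_set {0..1::real}) \<kappa>"
      "\<kappa> 0 = 0" "\<kappa> ` (- (W \<inter> V)) \<subseteq> {1}"
    by auto
  have cont: "continuous_on UNIV \<kappa>"
    using \<kappa>(1) by (simp add: continuous_map_in_subtopology)
  define k where "k x = (1 - \<kappa> x) * (1 - \<kappa> (- x))" for x
  show thesis
  proof (rule that)
    have "continuous_on UNIV (\<lambda>x. \<kappa> (- x))"
      by (intro continuous_on_compose2[OF cont] continuous_intros) auto
    then show "continuous_on UNIV k"
      unfolding k_def by (intro continuous_intros cont)
    show "k (- x) = k x" for x by (simp add: k_def)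
    show "0 < k 0" by (simp add: k_def \<kappa>)
    show "{x. 0 < k x} \<subseteq> W \<inter> K"
    proof
      fix x assume "x \<in> {x. 0 < k x}"
      then have "\<kappa> x \<noteq> 1" by (auto simp: k_def)
      then have "x \<in> W \<inter> V" using \<kappa>(3) by auto
      then show "x \<in> W \<inter> K" using V by auto
    qed
  qed (rule K)
qed

text \<open>The level sets \<open>E n\<close> have finite measure by Markov's inequality, lie in
  open sets of finite measure by outer regularity, and these are exhausted by compact sets up to
  null sets. A Haar measure may fail to be sigma-finite; this supplies the sigma-finite part on
  which Tonelli's theorem is applied.\<close>

lemma integrable_sigma_compact_support:
  fixes h :: "'a::t2_space \<Rightarrow> real"
  assumes radon: "radon_measure \<mu>" and h: "integrable \<mu> h" "\<And>x. 0 \<le> h x"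
  obtains B :: "nat \<Rightarrow> 'a set" where "\<And>n. compact (B n)" "AE x in \<mu>. x \<notin> (\<Union>n. B n) \<longrightarrow> h x = 0"
proof -
  note sets = radon_measureD(1)[OF radon]
  have space: "space \<mu> = UNIV" using sets_eq_imp_space_eq[OF sets] by simp
  define E where "E n = {x \<in> space \<mu>. 1 / real (Suc n) \<le> h x}" for n
  have hm: "h \<in> borel_measurable \<mu>" using h by simp
  have E_sets: "E n \<in> sets \<mu>" for n
    unfolding E_def using hm by measurable
  have E_fin: "emeasure \<mu> (E n) < \<infinity>" for n
  proof -
    have "emeasure \<mu> (E n) \<le> ennreal (1 / (1 / real (Suc n)) * (\<integral>x. h x \<partial>\<mu>))"
      unfolding E_def by (rule integral_Markov_inequality[OF h(1)]) (use h in auto)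
    then show ?thesis by (rule le_less_trans) simp
  qed
  have "\<exists>U. open U \<and> E n \<subseteq> U \<and> emeasure \<mu> U < \<infinity>" for n
  proof -
    have "emeasure \<mu> (E n) = (INF U\<in>{U. open U \<and> E n \<subseteq> U}. emeasure \<mu> U)"
      using E_sets by (intro radon_measureD(3)[OF radon]) (simp add: sets)
    then show ?thesis
      using E_fin[of n] by (auto simp: INF_less_iff)
  qed
  then obtain U where U: "\<And>n. open (U n)" "\<And>n. E n \<subseteq> U n" "\<And>n. emeasure \<mu> (U n) < \<infinity>"
    by metis
  have "\<exists>L. compact L \<and> L \<subseteq> U n \<and> emeasure \<mu> (U n) < emeasure \<mu> L + ennreal (1 / Suc j)" for n j
  proof -
    have "\<exists>L\<in>{L. compact L \<and> L \<subseteq> U n}. emeasure \<mu> (U n) < emeasure \<mu> L + ennreal (1 / Suc j)"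
      using U(3)[of n]
      by (intro SUP_approx_ennreal radon_measureD(4)[OF radon U(1)]) auto
    then show ?thesis by blast
  qed
  then obtain L where L: "\<And>n j. compact (L n j)" "\<And>n j. L n j \<subseteq> U n"
    "\<And>n j. emeasure \<mu> (U n) < emeasure \<mu> (L n j) + ennreal (1 / Suc j)"
    by metis
  have L_sets: "L n j \<in> sets \<mu>" for n j
    using L(1) by (simp add: sets borel_closed compact_imp_closed)
  have U_sets: "U n \<in> sets \<mu>" for n using U(1) by (simp add: sets)
  have null: "U n - (\<Union>j. L n j) \<in> null_sets \<mu>" for n
  proof -
    have eps: "emeasure \<mu> (U n - (\<Union>j. L n j)) \<le> 0 + ennreal e" if "0 < e" for e
    proof -
      obtain j where j: "1 / real (Suc j) < e" using nat_approx_posE[OF \<open>0 < e\<close>] by auto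
      have Lfin: "emeasure \<mu> (L n j) \<noteq> \<infinity>"
        using radon_measureD(2)[OF radon L(1)[of n j]] by simp
      have "emeasure \<mu> (U n - (\<Union>j. L n j)) \<le> emeasure \<mu> (U n - L n j)"
        using U_sets L_sets by (intro emeasure_mono) auto
      also have "\<dots> = emeasure \<mu> (U n) - emeasure \<mu> (L n j)"
        using U_sets L_sets L(2) Lfin by (intro emeasure_Diff) auto
      also have "\<dots> \<le> ennreal (1 / Suc j)"
        using L(3)[of n j] U(3)[of n] by (simp add: ennreal_minus_le_iff less_top less_imp_le)
      also have "\<dots> \<le> ennreal e" using j by (intro ennreal_leI) simp
      finally show ?thesis by simp
    qed
    have "emeasure \<mu> (U n - (\<Union>j. L n j)) \<le> 0"
      by (rule ennreal_le_epsilon) (rule eps)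
    then show ?thesis using U_sets L_sets by auto
  qed
  define B where "B i = L (fst (prod_decode i)) (snd (prod_decode i))" for i
  have UB: "(\<Union>i. B i) = (\<Union>n j. L n j)"
  proof (intro subset_antisym subsetI)
    fix x assume "x \<in> (\<Union>n j. L n j)"
    then obtain n j where "x \<in> L n j" by blast
    then have "x \<in> B (prod_encode (n, j))" by (simp add: B_def)
    then show "x \<in> (\<Union>i. B i)" by blast
  qed (auto simp: B_def)
  show thesis
  proof (rule that)
    show "compact (B i)" for i using L(1) by (simp add: B_def)
    show "AE x in \<mu>. x \<notin> (\<Union>i. B i) \<longrightarrow> h x = 0"
    proof (rule AE_I')
      show "(\<Union>n. U n - (\<Union>j. L n j)) \<in> null_sets \<mu>"
        using null by (intro null_sets_UN) auto
      show "{x \<in> space \<mu>. \<not> (x \<notin> (\<Union>i. B i) \<longrightarrow> h x = 0)} \<subseteq> (\<Union>n. U n - (\<Union>j. L n j))"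
      proof
        fix x assume "x \<in> {x \<in> space \<mu>. \<not> (x \<notin> (\<Union>i. B i) \<longrightarrow> h x = 0)}"
        then have x: "x \<notin> (\<Union>n j. L n j)" "0 < h x"
          using h(2)[of x] UB by auto
        obtain n where "1 / real (Suc n) < h x" using nat_approx_posE[OF x(2)] by auto
        then have "x \<in> E n" by (simp add: E_def space)
        then show "x \<in> (\<Union>n. U n - (\<Union>j. L n j))" using U(2) x by auto
      qed
    qed
  qed
qed

text \<open>The complement of the union has density 0, so it is a null set and completes the
  \<open>B n\<close> to a countable cover by sets of finite measure.\<close>

lemma sigma_finite_density_indicator:
  assumes "\<And>n::nat. B n \<in> sets M" "\<And>n. emeasure M (B n) < \<infinity>"
  shows "sigma_finite_measure (density M (\<lambda>x. ennreal (indicator (\<Union>n. B n) x)))"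
proof
  let ?Y = "\<Union>n. B n" and ?N = "density M (\<lambda>x. ennreal (indicator (\<Union>n. B n) x))"
  have Y: "?Y \<in> sets M" using assms by auto
  have ind: "(\<lambda>x. ennreal (indicator ?Y x)) = indicator ?Y"
    by (auto simp: fun_eq_iff indicator_def)
  have em: "emeasure ?N A = emeasure M (?Y \<inter> A)" if "A \<in> sets M" for A
    using that Y unfolding ind by (simp add: emeasure_density nn_integral_indicator' indicator_inter_arith[symmetric] sets.Int)
  let ?A = "insert (space M - ?Y) (range B)"
  have "countable ?A" "?A \<subseteq> sets ?N" "\<Union>?A = space ?N"
    using assms Y sets.sets_into_space by fastforce+
  moreover have "\<forall>a\<in>?A. emeasure ?N a \<noteq> \<infinity>"
  proof
    fix a assume "a \<in> ?A"
    then consider "a = space M - ?Y" | n where "a = B n" by blast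
    then show "emeasure ?N a \<noteq> \<infinity>"
    proof cases
      case 1
      then show ?thesis using em[of a] Y by (simp add: Diff_disjoint)
    next
      case 2
      then have "?Y \<inter> a = B n" by auto
      then show ?thesis using em[of a] assms 2 by (simp add: less_top)
    qed
  qed
  ultimately show "\<exists>A. countable A \<and> A \<subseteq> sets ?N \<and> \<Union>A = space ?N \<and> (\<forall>a\<in>A. emeasure ?N a \<noteq> \<infinity>)"
    by blast
qed

text \<open>Integrate \<open>powr_tangent_line\<close> over \<open>V\<close> at the mean value
  \<open>t = I / u\<close>; this is Jensen's inequality on \<open>V\<close>, rescaled by its
  measure.\<close>

lemma powr_integral_le:
  fixes a :: "'a \<Rightarrow> real"
  assumes V: "V \<in> sets M" "emeasure M V < \<infinity>" "0 < measure M V" and "1 < p"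
    and a: "\<And>x. 0 \<le> a x"
    and int: "integrable M (\<lambda>x. indicator V x * a x)" "integrable M (\<lambda>x. indicator V x * a x powr p)"
  shows "(\<integral>x. indicator V x * a x \<partial>M) powr p
    \<le> measure M V powr (p - 1) * (\<integral>x. indicator V x * a x powr p \<partial>M)"
proof -
  define u where "u = measure M V"
  have u: "0 < u" using V by (simp add: u_def)
  define I where "I = (\<integral>x. indicator V x * a x \<partial>M)"
  define t where "t = I / u"
  have I: "0 \<le> I" unfolding I_def using a by (intro Bochner_Integration.integral_nonneg) auto
  then have t: "0 \<le> t" "I = t * u" using u by (auto simp: t_def)
  have V_int: "integrable M (indicator V :: 'a \<Rightarrow> real)" using V by simp
  have "(\<integral>x. (p * t powr (p - 1)) * (indicator V x * a x) \<partial>M)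
      \<le> (\<integral>x. indicator V x * a x powr p + ((p - 1) * t powr p) * indicator V x \<partial>M)"
  proof (rule integral_mono)
    show "integrable M (\<lambda>x. (p * t powr (p - 1)) * (indicator V x * a x))"
      by (intro integrable_mult_right int)
    show "integrable M (\<lambda>x. indicator V x * a x powr p + ((p - 1) * t powr p) * indicator V x)"
      by (intro Bochner_Integration.integrable_add integrable_mult_right int V_int)
    show "(p * t powr (p - 1)) * (indicator V x * a x)
        \<le> indicator V x * a x powr p + ((p - 1) * t powr p) * indicator V x" for x
      using powr_tangent_line[OF a[of x] t(1) assms(4)] by (auto simp: indicator_def)
  qed
  also have "\<dots> = (\<integral>x. indicator V x * a x powr p \<partial>M) + ((p - 1) * t powr p) * u"
    using V int V_int by (simp add: u_def)
  also have "(\<integral>x. (p * t powr (p - 1)) * (indicator V x * a x) \<partial>M) = p * (t powr (p - 1) * t) * u"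
    by (simp only: integral_mult_right_zero I_def[symmetric] t(2) mult.assoc)
  also have "t powr (p - 1) * t = t powr p" using t assms(4) by (intro powr_mult_self) auto
  finally have le: "t powr p * u \<le> (\<integral>x. indicator V x * a x powr p \<partial>M)"
    by (simp add: algebra_simps)
  have "I powr p = t powr p * u powr p" using t u by (simp add: powr_mult)
  also have "u powr p = u powr (p - 1) * u"
    using u assms(4) by (simp add: powr_mult_self)
  finally have "I powr p = u powr (p - 1) * (t powr p * u)" by (simp add: mult_ac)
  also have "\<dots> \<le> u powr (p - 1) * (\<integral>x. indicator V x * a x powr p \<partial>M)"
    by (intro mult_left_mono le) auto
  finally show ?thesis by (simp add: I_def u_def)
qed

section \<open>Convolution with the indicator of a symmetric neighbourhood\<close>

context
  fixes \<mu> :: "'a::{topological_group_add, t2_space} measure" and p u :: real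
    and k :: "'a \<Rightarrow> real" and K U :: "'a set"
  assumes haar: "left_haar_measure \<mu>" and p: "1 < p"
    and k_cont: "continuous_on UNIV k" and k_sym: "\<And>x. k (- x) = k x" and k0: "0 < k 0"
    and K: "compact K" and U_def: "U = {x. 0 < k x}" and U_K: "U \<subseteq> K"
    and u_def: "u = measure \<mu> U"
begin

lemma sets_mu: "sets \<mu> = sets borel"
  by (rule radon_measureD(1)[OF left_haar_measureD(1)[OF haar]])

lemma open_U: "open U"
  unfolding U_def using k_cont by (intro open_Collect_less continuous_intros)

lemma U_sym: "- x \<in> U \<longleftrightarrow> x \<in> U"
  by (simp add: U_def k_sym)

lemma translate_U: "{y. - x + y \<in> U} = (\<lambda>y. x + y) ` U"
proof (intro set_eqI iffI)
  fix y assume "y \<in> {y. - x + y \<in> U}"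
  then have "x + (- x + y) \<in> (\<lambda>y. x + y) ` U" by (intro imageI) simp
  then show "y \<in> (\<lambda>y. x + y) ` U" by (simp add: add.assoc[symmetric])
qed (auto simp: add.assoc[symmetric])

text \<open>Since \<open>U\<close> is symmetric, \<open>- y + x\<close> and its inverse
  \<open>- x + y\<close> lie in \<open>U\<close> together; the resulting set has measure
  \<open>u\<close> by left invariance.\<close>

lemma reflect_U: "{y. - y + x \<in> U} = (\<lambda>y. x + y) ` U"
proof -
  have "- y + x \<in> U \<longleftrightarrow> - x + y \<in> U" for y
    using U_sym[of "- y + x"] by (simp add: minus_add)
  then show ?thesis by (simp add: translate_U[symmetric])
qed

lemma emeasure_U_finite: "emeasure \<mu> U < \<infinity>"
proof -
  have "emeasure \<mu> U \<le> emeasure \<mu> K"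
    using K by (intro emeasure_mono U_K) (simp add: sets_mu borel_closed compact_imp_closed)
  also have "\<dots> < \<infinity>"
    by (rule radon_measureD(2)[OF left_haar_measureD(1)[OF haar] K])
  finally show ?thesis .
qed

lemma emeasure_U: "emeasure \<mu> U = ennreal u"
  using emeasure_U_finite by (simp add: u_def emeasure_eq_ennreal_measure less_top)

lemma u_pos: "0 < u"
proof -
  have "emeasure \<mu> U \<noteq> 0"
    using k0 by (intro haar_measure_open_pos[OF haar open_U]) (simp add: U_def)
  then show ?thesis using emeasure_U by (metis ennreal_eq_0_iff not_le)
qed

lemma translate_U_sets: "(\<lambda>y. x + y) ` U \<in> sets \<mu>"
  using open_translation_group[OF open_U] by (simp add: sets_mu)

lemma emeasure_translate_U: "emeasure \<mu> ((\<lambda>y. x + y) ` U) = ennreal u"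
  using left_haar_measureD(3)[OF haar, of U x] open_U by (simp add: emeasure_U)

lemma measure_translate_U: "measure \<mu> ((\<lambda>y. x + y) ` U) = u"
  using emeasure_translate_U u_pos by (simp add: measure_def)

lemma indicator_U_in_Lp_space:
  "(\<lambda>x. of_real (indicator U x)) \<in> Lp_space \<mu> p"
  "Lp_norm \<mu> p (\<lambda>x. of_real (indicator U x)) = u powr (1 / p)"
proof -
  have eq: "norm (of_real (indicator U x) :: complex) powr p = indicator U x" for x
    by (simp add: indicator_def)
  have [measurable]: "U \<in> sets \<mu>" using open_U by (simp add: sets_mu)
  have "integrable \<mu> (indicator U :: 'a \<Rightarrow> real)"
    using emeasure_U_finite by (intro integrable_real_indicator) auto
  then show "(\<lambda>x. of_real (indicator U x)) \<in> Lp_space \<mu> p"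
    unfolding Lp_space_def mem_Collect_eq eq by (intro conjI) measurable
  show "Lp_norm \<mu> p (\<lambda>x. of_real (indicator U x)) = u powr (1 / p)"
    unfolding Lp_norm_def eq by (simp add: u_def)
qed

text \<open>The set is a countable union of superlevel sets of \<open>k (- snd z + fst z)\<close> in
  compact boxes, to which \<open>continuous_superlevel_in_product_sigma\<close> applies.\<close>

lemma product_measurable_translates:
  fixes A B :: "nat \<Rightarrow> 'a set"
  assumes "\<And>n. compact (A n)" "\<And>n. compact (B n)"
  shows "{z. fst z \<in> (\<Union>n. A n) \<and> snd z \<in> (\<Union>n. B n) \<and> - snd z + fst z \<in> U} \<in> sets (borel \<Otimes>\<^sub>M borel)"
proof -
  have cont: "continuous_on UNIV (\<lambda>z :: 'a \<times> 'a. k (- snd z + fst z))"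
    by (intro continuous_on_compose2[OF k_cont] continuous_intros) auto
  have eq: "{z. fst z \<in> (\<Union>n. A n) \<and> snd z \<in> (\<Union>n. B n) \<and> - snd z + fst z \<in> U}
      = (\<Union>i. \<Union>j. {z \<in> A i \<times> B j. 0 < k (- snd z + fst z)})"
    unfolding U_def by auto
  show ?thesis
    unfolding eq
    by (intro sets.countable_nat_UN image_subsetI continuous_superlevel_in_product_sigma[OF cont] assms)
qed

text \<open>\<open>powr_integral_le\<close> bounds the p-th power of the convolution at
  \<open>x\<close> by \<open>u powr (p - 1)\<close> times the integral of \<open>h\<close> over
  \<open>V x\<close>. Integrating over \<open>x\<close> with Tonelli's theorem gives another factor
  \<open>u\<close>, the measure of the set of \<open>x\<close> with
  \<open>- y + x \<in> U\<close>.\<close>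

lemma convolution_indicator_bound:
  assumes g: "g \<in> Lp_space \<mu> p"
  defines "f \<equiv> (\<lambda>x. complex_of_real (indicator U x))"
  shows "convolution_exists \<mu> g f" "convolution \<mu> g f \<in> Lp_space \<mu> p"
    "Lp_norm \<mu> p (convolution \<mu> g f) \<le> u * Lp_norm \<mu> p g"
proof -
  define h where "h y = norm (g y) powr p" for y
  have g_meas: "g \<in> borel_measurable \<mu>" and h_int: "integrable \<mu> h"
    using g by (auto simp: Lp_space_def h_def[abs_def])
  have h_nonneg: "0 \<le> h y" for y by (simp add: h_def)
  have f_eq: "f (- y + x) = of_real (indicator ((\<lambda>y. x + y) ` U) y)" for x y
    using reflect_U[of x] by (auto simp: f_def indicator_def)
  define V where "V x = (\<lambda>y. x + y) ` U" for x
  have V_sets: "V x \<in> sets \<mu>" and V_em: "emeasure \<mu> (V x) < \<infinity>" and V_meas: "measure \<mu> (V x) = u" for x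
    using translate_U_sets emeasure_translate_U[of x] measure_translate_U by (auto simp: V_def)
  have V_int: "integrable \<mu> (indicator (V x) :: 'a \<Rightarrow> real)" for x
    using V_sets V_em by simp
  have hV_int: "integrable \<mu> (\<lambda>y. indicator (V x) y * h y)" for x
    using integrable_mult_indicator[OF V_sets h_int] by simp
  \<comment> \<open>This dominates \<open>norm (g y)\<close> by an integrable function on the sets
    \<open>V x\<close> of finite measure.\<close>
  have norm_le: "norm (g y) \<le> 1 + h y" for y
  proof (cases "norm (g y) \<le> 1")
    case False
    then have "norm (g y) powr 1 \<le> norm (g y) powr p" using p by (intro powr_mono) auto
    then show ?thesis using False by (simp add: h_def)
  qed (use h_nonneg[of y] in simp)
  have gV_int: "integrable \<mu> (\<lambda>y. g y * f (- y + x))" for x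
  proof (rule Bochner_Integration.integrable_bound)
    show "integrable \<mu> (\<lambda>y. indicator (V x) y + indicator (V x) y * h y)"
      by (intro Bochner_Integration.integrable_add V_int hV_int)
    show "(\<lambda>y. g y * f (- y + x)) \<in> borel_measurable \<mu>"
      unfolding f_eq V_def[symmetric] using g_meas V_sets by measurable
    show "AE y in \<mu>. norm (g y * f (- y + x)) \<le> norm (indicator (V x) y + indicator (V x) y * h y)"
      using norm_le h_nonneg
      by (intro always_eventually allI) (auto simp: f_eq V_def[symmetric] indicator_def norm_mult intro: order_trans[OF _ abs_ge_self])
  qed
  then show ex: "convolution_exists \<mu> g f"
    by (simp add: convolution_exists_def)
  have gV_int': "integrable \<mu> (\<lambda>y. indicator (V x) y * norm (g y))" for x
    using integrable_norm[OF gV_int[of x]] by (simp add: f_eq V_def[symmetric] norm_mult mult.commute)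
  have conv_le: "norm (convolution \<mu> g f x) powr p \<le> u powr (p - 1) * (\<integral>y. indicator (V x) y * h y \<partial>\<mu>)" for x
  proof -
    have "norm (convolution \<mu> g f x) \<le> (\<integral>y. norm (g y * f (- y + x)) \<partial>\<mu>)"
      unfolding convolution_def by (rule integral_norm_bound)
    also have "\<dots> = (\<integral>y. indicator (V x) y * norm (g y) \<partial>\<mu>)"
      by (simp add: f_eq V_def[symmetric] norm_mult mult.commute)
    finally have "norm (convolution \<mu> g f x) powr p \<le> (\<integral>y. indicator (V x) y * norm (g y) \<partial>\<mu>) powr p"
      using p by (intro powr_mono2) auto
    also have "\<dots> \<le> u powr (p - 1) * (\<integral>y. indicator (V x) y * h y \<partial>\<mu>)"
      using powr_integral_le[of "V x" \<mu> p "\<lambda>y. norm (g y)"] V_sets V_em V_meas u_pos p gV_int' hV_int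
      by (simp add: h_def)
    finally show ?thesis .
  qed
  obtain B :: "nat \<Rightarrow> 'a set" where B: "\<And>n. compact (B n)"
    and supp: "AE y in \<mu>. y \<notin> (\<Union>n. B n) \<longrightarrow> h y = 0"
    using integrable_sigma_compact_support[OF left_haar_measureD(1)[OF haar] h_int h_nonneg] by blast
  define Y where "Y = (\<Union>n. B n)"
  \<comment> \<open>\<open>X\<close> is the sum of \<open>Y\<close> and \<open>K\<close>: it
    contains every \<open>x\<close> reached from a point of \<open>Y\<close> by an element of
    \<open>U\<close>, and it is again sigma-compact.\<close>
  define A where "A n = (\<lambda>(b, c). b + c) ` (B n \<times> K)" for n
  define X where "X = (\<Union>n. A n)"
  have A: "compact (A n)" for n
    unfolding A_def by (intro compact_continuous_image compact_Times B K)
      (auto simp: case_prod_unfold intro!: continuous_intros)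
  have X_mem: "x \<in> X" if yx: "y \<in> Y" "- y + x \<in> U" for x y
  proof -
    obtain n where "y \<in> B n" using yx(1) by (auto simp: Y_def)
    moreover have "- y + x \<in> K" using yx(2) U_K by blast
    ultimately have "(\<lambda>(b, c). b + c) (y, - y + x) \<in> A n"
      unfolding A_def by (intro imageI) auto
    then show ?thesis by (auto simp: X_def add.assoc[symmetric])
  qed
  \<comment> \<open>The restriction to the sigma-compact sets \<open>X\<close> and \<open>Y\<close>
    puts the relation into the product of the Borel algebras, by
    \<open>product_measurable_translates\<close>.\<close>
  define D where "D = {z. fst z \<in> X \<and> snd z \<in> Y \<and> - snd z + fst z \<in> U}"
  have D: "D \<in> sets (borel \<Otimes>\<^sub>M borel)"
    unfolding D_def X_def Y_def by (rule product_measurable_translates[OF A B])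
  have compact_fin: "emeasure \<mu> C < \<infinity>" "C \<in> sets \<mu>" if "compact C" for C
    using radon_measureD(2)[OF left_haar_measureD(1)[OF haar] that] that
    by (auto simp: sets_mu borel_closed compact_imp_closed)
  \<comment> \<open>The restrictions of \<open>\<mu>\<close> to \<open>X\<close> and
    \<open>Y\<close>, which unlike \<open>\<mu>\<close> itself are sure to be sigma-finite.\<close>
  define MX where "MX = density \<mu> (\<lambda>x. ennreal (indicator X x))"
  define MY where "MY = density \<mu> (\<lambda>y. ennreal (indicator Y y))"
  have X_sets: "X \<in> sets \<mu>" and Y_sets: "Y \<in> sets \<mu>"
    using compact_fin(2) A B by (auto simp: X_def Y_def)
  have "sigma_finite_measure MX"
    unfolding MX_def X_def by (rule sigma_finite_density_indicator) (use compact_fin A in auto)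
  moreover have "sigma_finite_measure MY"
    unfolding MY_def Y_def by (rule sigma_finite_density_indicator) (use compact_fin B in auto)
  ultimately interpret pair_sigma_finite MX MY
    by (simp add: pair_sigma_finite_def)
  have sets_XY: "sets MX = sets borel" "sets MY = sets borel"
    by (simp_all add: MX_def MY_def sets_mu)
  have D': "D \<in> sets (MX \<Otimes>\<^sub>M MY)"
    using D sets_pair_measure_cong[OF sets_XY] by simp
  have D'': "D \<in> sets (\<mu> \<Otimes>\<^sub>M MY)"
    using D sets_pair_measure_cong[OF sets_mu sets_XY(2)] by simp
  have g_MY: "g \<in> borel_measurable MY" and h_MY: "h \<in> borel_measurable MY"
    using g_meas borel_measurable_integrable[OF h_int] by (auto simp: MY_def)
  have g_supp: "AE y in \<mu>. y \<notin> Y \<longrightarrow> g y = 0"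
    using supp by eventually_elim (auto simp: Y_def h_def)
  have ind_eq: "g y * f (- y + x) = indicator Y y *\<^sub>R (g y * of_real (indicator D (x, y)))"
    if "y \<notin> Y \<longrightarrow> g y = 0" for x y
    using that X_mem[of y x] by (auto simp: f_def D_def indicator_def)
  have D_mu: "D \<in> sets (\<mu> \<Otimes>\<^sub>M \<mu>)"
    using D sets_pair_measure_cong[OF sets_mu sets_mu] by simp
  have ind_sec: "indicator D (x, y) = indicator (Pair x -` D) y"
    "indicator D (x, y) = indicator ((\<lambda>x. (x, y)) -` D) x" for x y
    by (simp_all add: indicator_def)
  note secD1 [measurable] = sets_Pair1[OF D_mu]
  note secD2 [measurable] = sets_Pair2[OF D_mu]
  have secD_real: "(\<lambda>y. indicator D (x, y) :: real) \<in> borel_measurable \<mu>" for x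
    unfolding ind_sec(1) by (intro borel_measurable_indicator secD1)
  have secD_complex: "(\<lambda>y. of_real (indicator D (x, y)) :: complex) \<in> borel_measurable \<mu>" for x
    using secD_real by measurable
  have secD: "(\<lambda>y. indicator D (x, y) :: ennreal) \<in> borel_measurable \<mu>" for x
    unfolding ind_sec(1) by (intro borel_measurable_indicator secD1)
  have secD': "(\<lambda>x. indicator D (x, y) :: ennreal) \<in> borel_measurable \<mu>" for y
    unfolding ind_sec(2) by (intro borel_measurable_indicator secD2)
  have conv_eq: "convolution \<mu> g f x = (\<integral>y. g y * of_real (indicator D (x, y)) \<partial>MY)" for x
  proof -
    have "convolution \<mu> g f x = (\<integral>y. indicator Y y *\<^sub>R (g y * of_real (indicator D (x, y))) \<partial>\<mu>)"
      unfolding convolution_def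
    proof (rule integral_cong_AE)
      show "(\<lambda>y. g y * f (- y + x)) \<in> borel_measurable \<mu>"
        by (rule borel_measurable_integrable[OF gV_int])
      show "(\<lambda>y. indicator Y y *\<^sub>R (g y * of_real (indicator D (x, y)))) \<in> borel_measurable \<mu>"
        using secD_real[of x] g_meas Y_sets by measurable
      show "AE y in \<mu>. g y * f (- y + x) = indicator Y y *\<^sub>R (g y * of_real (indicator D (x, y)))"
        using g_supp by eventually_elim (rule ind_eq)
    qed
    also have "\<dots> = (\<integral>y. g y * of_real (indicator D (x, y)) \<partial>MY)"
      unfolding MY_def
      by (intro integral_density[symmetric] borel_measurable_times g_meas secD_complex
            borel_measurable_indicator Y_sets) simp
    finally show ?thesis .
  qed
  have conv_meas: "convolution \<mu> g f \<in> borel_measurable \<mu>"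
  proof -
    \<comment> \<open>Measurability in \<open>x\<close> asks only the inner measure to be
      sigma-finite, so \<open>\<mu>\<close> can stay on the outside.\<close>
    have "(\<lambda>x. \<integral>y. g y * of_real (indicator D (x, y)) \<partial>MY) \<in> borel_measurable \<mu>"
    proof (rule M2.borel_measurable_lebesgue_integral)
      have "(\<lambda>z. of_real (indicator D z) :: complex) \<in> borel_measurable (\<mu> \<Otimes>\<^sub>M MY)"
        using D'' by measurable
      then have "(\<lambda>z. g (snd z) * of_real (indicator D z)) \<in> borel_measurable (\<mu> \<Otimes>\<^sub>M MY)"
        by (intro borel_measurable_times measurable_compose[OF measurable_snd g_MY])
      then show "(\<lambda>(x, y). g y * of_real (indicator D (x, y))) \<in> borel_measurable (\<mu> \<Otimes>\<^sub>M MY)"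
        by (simp add: case_prod_unfold)
    qed
    then show ?thesis by (simp add: conv_eq[abs_def])
  qed
  have conv_off: "convolution \<mu> g f x = 0" if "x \<notin> X" for x
    using that by (simp add: conv_eq D_def)
  have h_ennreal: "(\<lambda>y. ennreal (h y)) \<in> borel_measurable \<mu>"
    using borel_measurable_integrable[OF h_int] by measurable
  have ind_X: "(\<lambda>x. ennreal (indicator X x)) \<in> borel_measurable \<mu>"
    using X_sets by measurable
  have ind_Y: "(\<lambda>y. ennreal (indicator Y y)) \<in> borel_measurable \<mu>"
    using Y_sets by measurable
  have conv_le': "ennreal (norm (convolution \<mu> g f x) powr p)
      \<le> ennreal (u powr (p - 1)) * (\<integral>\<^sup>+y. ennreal (h y) * indicator D (x, y) \<partial>MY)" if "x \<in> X" for x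
  proof -
    have "ennreal (norm (convolution \<mu> g f x) powr p)
        \<le> ennreal (u powr (p - 1) * (\<integral>y. indicator (V x) y * h y \<partial>\<mu>))"
      by (intro ennreal_leI conv_le)
    also have "\<dots> = ennreal (u powr (p - 1)) * ennreal (\<integral>y. indicator (V x) y * h y \<partial>\<mu>)"
      by (intro ennreal_mult') simp
    also have "ennreal (\<integral>y. indicator (V x) y * h y \<partial>\<mu>) = (\<integral>\<^sup>+y. ennreal (indicator (V x) y * h y) \<partial>\<mu>)"
      using hV_int h_nonneg by (intro nn_integral_eq_integral[symmetric]) auto
    also have "\<dots> = (\<integral>\<^sup>+y. ennreal (indicator Y y) * (ennreal (h y) * indicator D (x, y)) \<partial>\<mu>)"
    proof (rule nn_integral_cong_AE)
      show "AE y in \<mu>. ennreal (indicator (V x) y * h y)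
          = ennreal (indicator Y y) * (ennreal (h y) * indicator D (x, y))"
        using supp
      proof eventually_elim
        case (elim y)
        have "y \<in> V x \<longleftrightarrow> - y + x \<in> U" using reflect_U[of x] by (auto simp: V_def)
        then show ?case
          using elim that by (auto simp: D_def Y_def[symmetric] indicator_def)
      qed
    qed
    also have "\<dots> = (\<integral>\<^sup>+y. ennreal (h y) * indicator D (x, y) \<partial>MY)"
      unfolding MY_def
      by (intro nn_integral_density[symmetric] borel_measurable_times_ennreal h_ennreal secD ind_Y)
    finally show ?thesis .
  qed
  have F_meas: "(\<lambda>(x, y). ennreal (h y) * indicator D (x, y)) \<in> borel_measurable (MX \<Otimes>\<^sub>M MY)"
  proof -
    have "(\<lambda>z. ennreal (h (snd z))) \<in> borel_measurable (MX \<Otimes>\<^sub>M MY)"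
      by (intro measurable_compose[OF measurable_snd, of h] measurable_compose[OF _ measurable_ennreal] h_MY)
    then have "(\<lambda>z. ennreal (h (snd z)) * indicator D z) \<in> borel_measurable (MX \<Otimes>\<^sub>M MY)"
      by (intro borel_measurable_times_ennreal borel_measurable_indicator D')
    then show ?thesis by (simp add: case_prod_unfold)
  qed
  have "(\<integral>\<^sup>+x. ennreal (norm (convolution \<mu> g f x) powr p) \<partial>\<mu>)
      = (\<integral>\<^sup>+x. ennreal (indicator X x) * ennreal (norm (convolution \<mu> g f x) powr p) \<partial>\<mu>)"
    using conv_off by (intro nn_integral_cong) (auto simp: indicator_def)
  also have "\<dots> = (\<integral>\<^sup>+x. ennreal (norm (convolution \<mu> g f x) powr p) \<partial>MX)"
    unfolding MX_def using conv_meas X_sets by (intro nn_integral_density[symmetric]) auto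
  also have "\<dots> \<le> (\<integral>\<^sup>+x. ennreal (u powr (p - 1)) * (\<integral>\<^sup>+y. ennreal (h y) * indicator D (x, y) \<partial>MY) \<partial>MX)"
  proof (rule nn_integral_mono_AE)
    have "AE x in MX. x \<in> X"
      unfolding MX_def using X_sets by (subst AE_density) (auto simp: indicator_def)
    then show "AE x in MX. ennreal (norm (convolution \<mu> g f x) powr p)
        \<le> ennreal (u powr (p - 1)) * (\<integral>\<^sup>+y. ennreal (h y) * indicator D (x, y) \<partial>MY)"
      by eventually_elim (rule conv_le')
  qed
  also have "\<dots> = ennreal (u powr (p - 1)) * (\<integral>\<^sup>+x. \<integral>\<^sup>+y. ennreal (h y) * indicator D (x, y) \<partial>MY \<partial>MX)"
    using M2.borel_measurable_nn_integral[OF F_meas] by (intro nn_integral_cmult)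
  finally have step1: "(\<integral>\<^sup>+x. ennreal (norm (convolution \<mu> g f x) powr p) \<partial>\<mu>)
      \<le> ennreal (u powr (p - 1)) * (\<integral>\<^sup>+x. \<integral>\<^sup>+y. ennreal (h y) * indicator D (x, y) \<partial>MY \<partial>MX)" .
  have "(\<integral>\<^sup>+x. \<integral>\<^sup>+y. ennreal (h y) * indicator D (x, y) \<partial>MY \<partial>MX)
      = (\<integral>\<^sup>+y. \<integral>\<^sup>+x. ennreal (h y) * indicator D (x, y) \<partial>MX \<partial>MY)"
    using Fubini[OF F_meas] by simp
  \<comment> \<open>For fixed \<open>y\<close> the section of \<open>D\<close> lies in the translate
    \<open>V y\<close>, of measure \<open>u\<close>.\<close>
  also have "\<dots> \<le> (\<integral>\<^sup>+y. ennreal (h y) * ennreal u \<partial>MY)"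
  proof (rule nn_integral_mono)
    fix y
    have "(\<integral>\<^sup>+x. ennreal (h y) * indicator D (x, y) \<partial>MX)
        = (\<integral>\<^sup>+x. ennreal (indicator X x) * (ennreal (h y) * indicator D (x, y)) \<partial>\<mu>)"
      unfolding MX_def
      by (intro nn_integral_density borel_measurable_times_ennreal ind_X secD') simp
    also have "\<dots> \<le> (\<integral>\<^sup>+x. ennreal (h y) * indicator (V y) x \<partial>\<mu>)"
      using translate_U[of y] by (intro nn_integral_mono) (auto simp: D_def V_def indicator_def)
    also have "\<dots> = ennreal (h y) * ennreal u"
      using V_sets[of y] emeasure_translate_U[of y] by (subst nn_integral_cmult_indicator) (auto simp: V_def)
    finally show "(\<integral>\<^sup>+x. ennreal (h y) * indicator D (x, y) \<partial>MX) \<le> ennreal (h y) * ennreal u" .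
  qed
  also have "\<dots> = (\<integral>\<^sup>+y. ennreal (indicator Y y) * (ennreal (h y) * ennreal u) \<partial>\<mu>)"
    unfolding MY_def using Y_sets borel_measurable_integrable[OF h_int] by (intro nn_integral_density) auto
  also have "\<dots> \<le> (\<integral>\<^sup>+y. ennreal u * ennreal (h y) \<partial>\<mu>)"
    by (intro nn_integral_mono) (auto simp: indicator_def mult.commute)
  also have "\<dots> = ennreal u * ennreal (\<integral>y. h y \<partial>\<mu>)"
    using borel_measurable_integrable[OF h_int] nn_integral_eq_integral[OF h_int] h_nonneg
    by (subst nn_integral_cmult) auto
  finally have step2: "(\<integral>\<^sup>+x. \<integral>\<^sup>+y. ennreal (h y) * indicator D (x, y) \<partial>MY \<partial>MX)
      \<le> ennreal u * ennreal (\<integral>y. h y \<partial>\<mu>)" .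
  have "(\<integral>\<^sup>+x. ennreal (norm (convolution \<mu> g f x) powr p) \<partial>\<mu>)
      \<le> ennreal (u powr (p - 1)) * (ennreal u * ennreal (\<integral>y. h y \<partial>\<mu>))"
    by (rule order_trans[OF step1 mult_left_mono[OF step2]]) simp
  also have "\<dots> = ennreal (u powr p * (\<integral>y. h y \<partial>\<mu>))"
    using u_pos p powr_mult_self[of u p] Bochner_Integration.integral_nonneg[of \<mu> h] h_nonneg
    by (simp add: ennreal_mult[symmetric] mult.assoc[symmetric])
  finally have bound: "(\<integral>\<^sup>+x. ennreal (norm (convolution \<mu> g f x) powr p) \<partial>\<mu>)
      \<le> ennreal (u powr p * (\<integral>y. h y \<partial>\<mu>))" .
  have c_int: "integrable \<mu> (\<lambda>x. norm (convolution \<mu> g f x) powr p)"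
    using conv_meas bound by (intro integrableI_bounded) (auto intro: le_less_trans)
  then show "convolution \<mu> g f \<in> Lp_space \<mu> p"
    using conv_meas by (simp add: Lp_space_def)
  have "(\<integral>x. norm (convolution \<mu> g f x) powr p \<partial>\<mu>) \<le> u powr p * (\<integral>y. h y \<partial>\<mu>)"
    using bound nn_integral_eq_integral[OF c_int] h_nonneg
    by (simp add: ennreal_le_iff)
  then have "Lp_norm \<mu> p (convolution \<mu> g f) \<le> (u powr p * (\<integral>y. h y \<partial>\<mu>)) powr (1 / p)"
    unfolding Lp_norm_def using p by (intro powr_mono2) auto
  also have "\<dots> = u * Lp_norm \<mu> p g"
    using u_pos p h_nonneg by (simp add: Lp_norm_def h_def[symmetric] powr_mult powr_powr)
  finally show "Lp_norm \<mu> p (convolution \<mu> g f) \<le> u * Lp_norm \<mu> p g" .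
qed

lemma indicator_U_in_LpT_space:
  "(\<lambda>x. of_real (indicator U x)) \<in> LpT_space \<mu> p"
  "LpT_norm \<mu> p (\<lambda>x. of_real (indicator U x)) \<le> u"
proof -
  have "0 \<le> u" using u_pos by simp
  note * = LpT_spaceI[OF indicator_U_in_Lp_space(1) this]
  show "(\<lambda>x. of_real (indicator U x)) \<in> LpT_space \<mu> p"
    "LpT_norm \<mu> p (\<lambda>x. of_real (indicator U x)) \<le> u"
    by (rule *; intro conjI convolution_indicator_bound; assumption)+
qed

end

text \<open>If \<open>0\<close> were no atom, outer regularity would give symmetric \<open>U\<close>
  of arbitrarily small measure \<open>u\<close>. For its indicator the lower bound yields
  \<open>c * u powr (1 / p) \<le> u\<close>, which forces
  \<open>c \<le> u powr ((p - 1) / p)\<close>.\<close>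

lemma haar_atom_of_le_LpT_norm:
  fixes \<mu> :: "'a::{topological_group_add, t2_space} measure"
  assumes lc: "locally_compact_space (euclidean :: 'a topology)"
    and haar: "left_haar_measure \<mu>" and p: "1 < p"
    and c: "0 < c" "\<And>f. f \<in> LpT_space \<mu> p \<Longrightarrow> c * Lp_norm \<mu> p f \<le> LpT_norm \<mu> p f"
  shows "emeasure \<mu> {0} \<noteq> 0"
proof
  assume 0: "emeasure \<mu> {0} = 0"
  note radon = left_haar_measureD(1)[OF haar]
  \<comment> \<open>The value with \<open>\<epsilon> powr ((p - 1) / p) = c\<close>.\<close>
  define \<epsilon> where "\<epsilon> = c powr (p / (p - 1))"
  have \<epsilon>: "0 < \<epsilon>" using c by (simp add: \<epsilon>_def)
  have "emeasure \<mu> {0} = (INF W\<in>{W. open W \<and> {0} \<subseteq> W}. emeasure \<mu> W)"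
    by (rule radon_measureD(3)[OF radon]) simp
  moreover have "emeasure \<mu> {0} < ennreal \<epsilon>" using 0 \<epsilon> by simp
  ultimately obtain W where W: "open W" "0 \<in> W" "emeasure \<mu> W < ennreal \<epsilon>"
    by (auto simp: INF_less_iff)
  obtain k :: "'a \<Rightarrow> real" and K where k: "continuous_on UNIV k" "\<And>x. k (- x) = k x"
    "0 < k 0" "compact K" "{x. 0 < k x} \<subseteq> W \<inter> K"
    using symmetric_neighborhood[OF lc W(1,2)] by blast
  define U where "U = {x. 0 < k x}"
  define u where "u = measure \<mu> U"
  have U_K: "U \<subseteq> K" "U \<subseteq> W" using k(5) by (auto simp: U_def)
  note ctx = haar p k(1-4) U_def U_K(1) u_def
  have u: "0 < u" by (rule u_pos[OF ctx])
  have "emeasure \<mu> U \<le> emeasure \<mu> W"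
    using W by (intro emeasure_mono U_K) (simp add: radon_measureD(1)[OF radon])
  then have "u < \<epsilon>"
    using W(3) emeasure_U[OF ctx] u by (metis ennreal_less_iff le_less_trans less_imp_le)
  have "c * u powr (1 / p) \<le> u"
    using c(2)[OF indicator_U_in_LpT_space(1)[OF ctx]] indicator_U_in_LpT_space(2)[OF ctx]
    by (simp add: indicator_U_in_Lp_space(2)[OF ctx])
  also have "u = u powr ((p - 1) / p) * u powr (1 / p)"
    using u p by (simp add: powr_add[symmetric] diff_divide_distrib)
  finally have "c \<le> u powr ((p - 1) / p)"
    using u by simp
  also have "\<dots> < \<epsilon> powr ((p - 1) / p)"
    using \<open>u < \<epsilon>\<close> u p by (intro powr_less_mono2) auto
  also have "\<dots> = c" using c p by (simp add: \<epsilon>_def powr_powr)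
  finally show False by simp
qed

theorem corollary2p6:
  fixes \<mu> :: "'a::{topological_group_add, t2_space} measure" and p :: real
  assumes "locally_compact_space (euclidean :: 'a topology)"
    and "left_haar_measure \<mu>"
    and "unimodular_group TYPE('a)"
    and "1 < p" and "p \<le> 2"
  shows "equivalent_norms_on (LpT_space \<mu> p) (Lp_norm \<mu> p) (LpT_norm \<mu> p)
    \<longleftrightarrow> finite (UNIV :: 'a set)"
proof
  assume "equivalent_norms_on (LpT_space \<mu> p) (Lp_norm \<mu> p) (LpT_norm \<mu> p)"
  then obtain c C where c: "0 < c" "\<And>f. f \<in> LpT_space \<mu> p \<Longrightarrow> c * Lp_norm \<mu> p f \<le> LpT_norm \<mu> p f"
    and C: "0 < C" "\<And>f. f \<in> LpT_space \<mu> p \<Longrightarrow> LpT_norm \<mu> p f \<le> C * Lp_norm \<mu> p f"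
    by (auto simp: equivalent_norms_on_def)
  \<comment> \<open>The lower bound of the equivalence forces an atom; the upper bound then serves
    for the discrete group.\<close>
  obtain m where "0 < m" "\<mu> = density (count_space UNIV) (\<lambda>_. ennreal m)"
    using haar_measure_with_atom[OF assms(2) haar_atom_of_le_LpT_norm[OF assms(1,2,4) c]] by blast
  then show "finite (UNIV :: 'a set)"
    using assms(4,5) C by (rule finite_of_LpT_norm_le)
next
  assume fin: "finite (UNIV :: 'a set)"
  \<comment> \<open>All points have the same mass, and the total mass of the finite group is
    nonzero.\<close>
  have "emeasure \<mu> {0} \<noteq> 0"
  proof
    assume "emeasure \<mu> {0} = 0"
    then have "emeasure \<mu> UNIV = (\<Sum>x\<in>UNIV. 0)"
      using fin emeasure_translate_singleton[OF assms(2)]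
        radon_measureD(1)[OF left_haar_measureD(1)[OF assms(2)]]
      by (subst emeasure_eq_sum_singleton) auto
    then show False using left_haar_measureD(2)[OF assms(2)] by simp
  qed
  then obtain m where "0 < m" "\<mu> = density (count_space UNIV) (\<lambda>_. ennreal m)"
    using haar_measure_with_atom[OF assms(2)] by blast
  then show "equivalent_norms_on (LpT_space \<mu> p) (Lp_norm \<mu> p) (LpT_norm \<mu> p)"
    using assms(4) fin by (rule equivalent_norms_of_finite)
qed

end
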